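(* Let $\mathcal{A},\mathcal{B}\in\mathcal{G}_2^\Lambda(\mathbb{R}^d)$ and let $\mathcal{J}_*\in\Gamma(\mathcal{A},\mathcal{B})$ be a $2$-optimal L\'evy coupling of $\mathcal{A}$ and $\mathcal{B}$ (i.e. a $2$-optimal Markovian coupling that is itself a L\'evy generator). Denote by $\{Z_t=(X_t,Y_t)\}_{t\ge0}$ the L\'evy process on $\mathbb{R}^{2d}$ with generator $\mathcal{J}_*$. Then for all $T\ge0$, $$\mathbb{E}^{(0,0)}\Big[\sup_{t\in[0,T]}|X_t-Y_t|^2\Big]\le8\max\{T,T^2\}\,\mathcal{W}_{\mathcal G}(\mathcal{A},\mathcal{B})^2.$$ If, in addition, both processes have zero mean (i.e. $m_{\mathcal A}=m_{\mathcal B}=0$), then $$\mathbb{E}^{(0,0)}\Big[\sup_{t\in[0,T]}|X_t-Y_t|^2\Big]\le4T\,\mathcal{W}_{\mathcal G}(\mathcal{A},\mathcal{B})^2.$$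
   Context: $\mathbb{E}^{(0,0)}$ is expectation for the process started at $(0,0)$; L\'evy processes are taken with c\`adl\`ag paths. Semigroups. For a Polish space $\Pi$, a Feller semigroup is a family $\{T_t\}_{t\ge0}$ of bounded linear operators on the bounded Borel functions on $\Pi$ with $T_0=I$, $T_{t+s}=T_tT_s$, $T_t\varphi\ge0$ if $\varphi\ge0$, $T_t1=1$, $T_t(C_0(\Pi))\subset C_0(\Pi)$ and $T_t\varphi\to\varphi$ uniformly as $t\searrow0$ for $\varphi\in C_0(\Pi)$ (continuous functions vanishing at infinity). It acts through a transition kernel, $T_t\varphi(x)=\int\varphi(y)\,\kappa_t(x,dy)$, and this formula is used also for unbounded Borel $\varphi$ whenever the integral is well defined. Its generator is $\mathcal{A}\varphi=\lim_{t\searrow0}(T_t\varphi-\varphi)/t$ (limit in $C_0(\Pi)$) on the domain where the limit exists; one writes $T_t=e^{t\mathcal A}$. $\mathcal{G}(\Pi)$ is the set of Feller generators on $\Pi$. The continuity domain $C(\mathcal A)$ is the space of $\varphi\in C(\Pi)$ with $e^{t\mathcal A}\varphi\in C(\Pi)$ for all $t\ge0$ and $e^{t\mathcal A}\varphi\to e^{s\mathcal A}\varphi$ locally uniformly as $t\to s$. The extended domain $\bar D(\mathcal A)$ consists of $\varphi\in C(\mathcal A)$ such that for each $t\ge0$ there is $g_t\in C(\mathcal A)$ with $(e^{(t+h)\mathcal A}\varphi-e^{t\mathcal A}\varphi)/h\to g_t$ locally uniformly as $h\searrow0$; then $\mathcal A\varphi:=g_0$. The lower generator is $\mathcal{A}^-\varphi(x)=\liminf_{h\searrow0}(e^{h\mathcal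 A}\varphi(x)-\varphi(x))/h$ for Borel $\varphi$. L\'evy generators. A L\'evy measure on $\mathbb{R}^d$ is a Borel measure $\mu$ with $\mu(\{0\})=0$ and $\int\min\{1,|x|^2\}d\mu<\infty$; $\Lambda_2(\mathbb{R}^d)$ is the set of L\'evy measures with $\int|x|^2d\mu<\infty$. $\mathcal{G}_2^\Lambda(\mathbb{R}^d)$ is the set of generators of L\'evy processes with L\'evy measure in $\Lambda_2(\mathbb{R}^d)$, i.e. Feller generators acting on test functions by $$\varphi\mapsto\kappa\cdot\nabla\varphi(x)+\tfrac12\operatorname{tr}[\alpha D^2\varphi(x)]+\int_{\mathbb{R}^d\setminus\{0\}}[\varphi(x+x')-\varphi(x)-x'\cdot\nabla\varphi(x)]\,d\mu(x')$$ with $\kappa\in\mathbb{R}^d$, $\alpha$ symmetric nonnegative definite, $\mu\in\Lambda_2(\mathbb{R}^d)$. The mean vector is $m_{\mathcal A}=e^{\mathcal A}[x](0)$, the mean at time $1$ of the process started at $0$ (equal to $\kappa$ above). Couplings. Write $(\varphi\otimes1)(x,y)=\varphi(x)$, $(1\otimes\psi)(x,y)=\psi(y)$. $\Gamma(\mathcal A,\mathcal B)$ is the set of Feller generators $\mathcal J\in\mathcal G(\Pi^2)$ such that $e^{t\mathcal J}[\varphi\otimes1]=(e^{t\mathcal A}\varphi)\otimes1$ and $e^{t\mathcal J}[1\otimes\psi]=1\otimes(e^{t\mathcal B}\psi)$ for all $\varphi\in C(\mathcal A)$, $\psi\in C(\mathcal B)$, $t\ge0$. With $\Pi=\mathbb{R}^d$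 and $c_2(x,y)=\frac12|x-y|^2$, the Markovian transport derivative is $\theta_2(x,y;\mathcal A,\mathcal B)=\inf_{\mathcal J\in\Gamma(\mathcal A,\mathcal B)}(\mathcal J^-c_2)(x,y)$. A $2$-optimal Markovian coupling is $\mathcal J_*\in\Gamma(\mathcal A,\mathcal B)$ with $c_2\in\bar D(\mathcal J_* )$ and $(\mathcal J_*c_2)(x,y)=\theta_2(x,y;\mathcal A,\mathcal B)$ for all $(x,y)$. The Wasserstein generator metric is $\mathcal W_{\mathcal G}(\mathcal A,\mathcal B)\ge0$ with $\mathcal W_{\mathcal G}(\mathcal A,\mathcal B)^2=\frac12|m_{\mathcal A}-m_{\mathcal B}|^2+\theta_2(0,0;\mathcal A,\mathcal B)$. *)

theory Defs
  imports "HOL-Probability.Probability"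
begin

instance prod :: (polish_space, polish_space) polish_space ..

section \<open>Feller semigroups and their generators\<close>

definition C0 :: "('a::polish_space \<Rightarrow> real) set" where
  "C0 = {\<phi>. continuous_on UNIV \<phi> \<and> (\<forall>e>0. \<exists>K. compact K \<and> (\<forall>x. x \<notin> K \<longrightarrow> \<bar>\<phi> x\<bar> < e))}"

definition bounded_borel :: "('a::polish_space \<Rightarrow> real) set" where
  "bounded_borel = {\<phi> \<in> borel_measurable borel. bounded (range \<phi>)}"

type_synonym 'a kernels = "real \<Rightarrow> 'a \<Rightarrow> 'a measure"

definition kernel_op :: "'a::polish_space kernels \<Rightarrow> real \<Rightarrow> ('a \<Rightarrow> real) \<Rightarrow> 'a \<Rightarrow> real" where
  "kernel_op K t \<phi> x = (\<integral>y. \<phi> y \<partial>K t x)"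

text \<open>
  A Feller semigroup is given by its transition kernels; only the times \<open>t \<ge> 0\<close> matter. That each
  \<open>T\<^sub>t\<close> is a bounded linear operator on the bounded Borel functions, is positive and satisfies
  \<open>T\<^sub>t 1 = 1\<close> is the first conjunct, which says that \<open>K t\<close> is a Markov kernel.
\<close>

definition feller_semigroup :: "'a::polish_space kernels \<Rightarrow> bool" where
  "feller_semigroup K \<longleftrightarrow>
     (\<forall>t\<ge>0. K t \<in> borel \<rightarrow>\<^sub>M prob_algebra borel) \<and>
     (\<forall>\<phi>\<in>bounded_borel. kernel_op K 0 \<phi> = \<phi>) \<and>
     (\<forall>\<phi>\<in>bounded_borel. \<forall>t\<ge>0. \<forall>s\<ge>0. kernel_op K (t + s) \<phi> = kernel_op K t (kernel_op K s \<phi>)) \<and>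
     (\<forall>\<phi>\<in>C0. \<forall>t\<ge>0. kernel_op K t \<phi> \<in> C0) \<and>
     (\<forall>\<phi>\<in>C0. uniform_limit UNIV (\<lambda>t. kernel_op K t \<phi>) \<phi> (at_right 0))"

text \<open>Generators are partial operators on \<open>C0\<close>, represented by their graphs.\<close>

type_synonym 'a operator = "(('a \<Rightarrow> real) \<times> ('a \<Rightarrow> real)) set"

definition generator_of :: "'a::polish_space kernels \<Rightarrow> 'a operator" where
  "generator_of K = {(\<phi>, \<psi>). \<phi> \<in> C0 \<and> \<psi> \<in> C0 \<and>
     uniform_limit UNIV (\<lambda>t x. (kernel_op K t \<phi> x - \<phi> x) / t) \<psi> (at_right 0)}"

definition feller_generators :: "'a::polish_space operator set" where
  "feller_generators = {generator_of K | K. feller_semigroup K}"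

text \<open>
  The transition kernels of \<open>exp (t A)\<close>. On a locally compact space they are uniquely determined
  for \<open>t \<ge> 0\<close>: the generator determines the semigroup on \<open>C0\<close>, and this determines the kernels.
\<close>

definition kernel :: "'a::polish_space operator \<Rightarrow> 'a kernels" where
  "kernel A = (SOME K. feller_semigroup K \<and> generator_of K = A)"

definition exp_op :: "'a::polish_space operator \<Rightarrow> real \<Rightarrow> ('a \<Rightarrow> real) \<Rightarrow> 'a \<Rightarrow> real" where
  "exp_op A = kernel_op (kernel A)"

definition locally_uniform_limit ::
    "('b \<Rightarrow> 'a::topological_space \<Rightarrow> real) \<Rightarrow> ('a \<Rightarrow> real) \<Rightarrow> 'b filter \<Rightarrow> bool" where
  "locally_uniform_limit f g F \<longleftrightarrow> (\<forall>x. \<exists>U. open U \<and> x \<in> U \<and> uniform_limit U f g F)"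

definition continuity_domain :: "'a::polish_space operator \<Rightarrow> ('a \<Rightarrow> real) set" where
  "continuity_domain A = {\<phi>. continuous_on UNIV \<phi> \<and>
     (\<forall>t\<ge>0. (\<forall>x. integrable (kernel A t x) \<phi>) \<and> continuous_on UNIV (exp_op A t \<phi>)) \<and>
     (\<forall>s\<ge>0. locally_uniform_limit (\<lambda>t. exp_op A t \<phi>) (exp_op A s \<phi>) (at s within {0..}))}"

definition is_right_derivative ::
    "'a::polish_space operator \<Rightarrow> ('a \<Rightarrow> real) \<Rightarrow> real \<Rightarrow> ('a \<Rightarrow> real) \<Rightarrow> bool" where
  "is_right_derivative A \<phi> t g \<longleftrightarrow> g \<in> continuity_domain A \<and>
     locally_uniform_limit (\<lambda>h x. (exp_op A (t + h) \<phi> x - exp_op A t \<phi> x) / h) g (at_right 0)"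

definition extended_domain :: "'a::polish_space operator \<Rightarrow> ('a \<Rightarrow> real) set" where
  "extended_domain A =
     {\<phi> \<in> continuity_domain A. \<forall>t\<ge>0. \<exists>g. is_right_derivative A \<phi> t g}"

definition extended_generator :: "'a::polish_space operator \<Rightarrow> ('a \<Rightarrow> real) \<Rightarrow> 'a \<Rightarrow> real" where
  "extended_generator A \<phi> = (THE g. is_right_derivative A \<phi> 0 g)"

text \<open>The integral with values in \<open>[-\<infinity>, \<infinity>]\<close>; meaningful unless both parts are infinite.\<close>

definition ereal_integral :: "'a measure \<Rightarrow> ('a \<Rightarrow> real) \<Rightarrow> ereal" where
  "ereal_integral M \<phi> =
     enn2ereal (\<integral>\<^sup>+y. ennreal (\<phi> y) \<partial>M) - enn2ereal (\<integral>\<^sup>+y. ennreal (- \<phi> y) \<partial>M)"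

definition lower_generator :: "'a::polish_space operator \<Rightarrow> ('a \<Rightarrow> real) \<Rightarrow> 'a \<Rightarrow> ereal" where
  "lower_generator A \<phi> x =
     Liminf (at_right 0) (\<lambda>h. (ereal_integral (kernel A h x) \<phi> - ereal (\<phi> x)) / ereal h)"

section \<open>Levy generators\<close>

definition levy_measures :: "'a::euclidean_space measure set" where
  "levy_measures = {\<mu>. sets \<mu> = sets borel \<and> emeasure \<mu> {0} = 0 \<and>
     (\<integral>\<^sup>+x. ennreal (min 1 ((norm x)\<^sup>2)) \<partial>\<mu>) < \<infinity>}"

definition levy_measures2 :: "'a::euclidean_space measure set" where
  "levy_measures2 = {\<mu> \<in> levy_measures. (\<integral>\<^sup>+x. ennreal ((norm x)\<^sup>2) \<partial>\<mu>) < \<infinity>}"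

primrec Ck :: "nat \<Rightarrow> ('a::euclidean_space \<Rightarrow> real) \<Rightarrow> bool" where
  "Ck 0 \<phi> \<longleftrightarrow> continuous_on UNIV \<phi>"
| "Ck (Suc k) \<phi> \<longleftrightarrow>
     \<phi> differentiable_on UNIV \<and> (\<forall>v. Ck k (\<lambda>x. frechet_derivative \<phi> (at x) v))"

definition test_functions :: "('a::euclidean_space \<Rightarrow> real) set" where
  "test_functions = {\<phi>. (\<forall>k. Ck k \<phi>) \<and> compact (closure {x. \<phi> x \<noteq> 0})}"

definition gradient :: "('a::euclidean_space \<Rightarrow> real) \<Rightarrow> 'a \<Rightarrow> 'a" where
  "gradient \<phi> x = (\<Sum>b\<in>Basis. frechet_derivative \<phi> (at x) b *\<^sub>R b)"

definition hessian :: "('a::euclidean_space \<Rightarrow> real) \<Rightarrow> 'a \<Rightarrow> 'a \<Rightarrow> 'a" where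
  "hessian \<phi> x = frechet_derivative (gradient \<phi>) (at x)"

definition trace_op :: "('a::euclidean_space \<Rightarrow> 'a) \<Rightarrow> real" where
  "trace_op L = (\<Sum>b\<in>Basis. L b \<bullet> b)"

definition sym_nonneg :: "('a::euclidean_space \<Rightarrow> 'a) \<Rightarrow> bool" where
  "sym_nonneg \<alpha> \<longleftrightarrow> linear \<alpha> \<and> (\<forall>x y. \<alpha> x \<bullet> y = x \<bullet> \<alpha> y) \<and> (\<forall>x. 0 \<le> x \<bullet> \<alpha> x)"

text \<open>The set \<open>C\<close> is the region of jumps that are compensated.\<close>

definition levy_khintchine ::
    "'a::euclidean_space set \<Rightarrow> 'a \<Rightarrow> ('a \<Rightarrow> 'a) \<Rightarrow> 'a measure \<Rightarrow> ('a \<Rightarrow> real) \<Rightarrow> 'a \<Rightarrow> real" where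
  "levy_khintchine C \<kappa> \<alpha> \<mu> \<phi> x =
     \<kappa> \<bullet> gradient \<phi> x + trace_op (\<alpha> \<circ> hessian \<phi> x) / 2 +
     (LINT x':UNIV - {0}|\<mu>. \<phi> (x + x') - \<phi> x - indicator C x' * (x' \<bullet> gradient \<phi> x))"

definition levy_generators :: "'a::euclidean_space operator set" where
  "levy_generators = {A \<in> feller_generators. \<exists>\<kappa> \<alpha> \<mu>. sym_nonneg \<alpha> \<and> \<mu> \<in> levy_measures \<and>
     (\<forall>\<phi>\<in>test_functions. (\<phi>, levy_khintchine (cball 0 1) \<kappa> \<alpha> \<mu> \<phi>) \<in> A)}"

definition levy_generators2 :: "'a::euclidean_space operator set" where
  "levy_generators2 = {A \<in> feller_generators. \<exists>\<kappa> \<alpha> \<mu>. sym_nonneg \<alpha> \<and> \<mu> \<in> levy_measures2 \<and>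
     (\<forall>\<phi>\<in>test_functions. (\<phi>, levy_khintchine UNIV \<kappa> \<alpha> \<mu> \<phi>) \<in> A)}"

definition mean_vector :: "'a::euclidean_space operator \<Rightarrow> 'a" where
  "mean_vector A = (\<integral>x. x \<partial>kernel A 1 0)"

section \<open>Couplings\<close>

text \<open>
  The integrability conditions state that \<open>exp (t J)\<close> is defined on \<open>\<phi> \<otimes> 1\<close> and \<open>1 \<otimes> \<psi>\<close>, so that
  the equations are not affected by the value \<open>0\<close> of the integral of a non-integrable function.
\<close>

definition couplings ::
    "'a::polish_space operator \<Rightarrow> 'a operator \<Rightarrow> ('a \<times> 'a) operator set" where
  "couplings A B = {J \<in> feller_generators.
     (\<forall>\<phi>\<in>continuity_domain A. \<forall>t\<ge>0. \<forall>x y.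
        integrable (kernel J t (x, y)) (\<lambda>(x, y). \<phi> x) \<and>
        exp_op J t (\<lambda>(x, y). \<phi> x) (x, y) = exp_op A t \<phi> x) \<and>
     (\<forall>\<psi>\<in>continuity_domain B. \<forall>t\<ge>0. \<forall>x y.
        integrable (kernel J t (x, y)) (\<lambda>(x, y). \<psi> y) \<and>
        exp_op J t (\<lambda>(x, y). \<psi> y) (x, y) = exp_op B t \<psi> y)}"

definition c2 :: "'a::euclidean_space \<times> 'a \<Rightarrow> real" where
  "c2 = (\<lambda>(x, y). (norm (x - y))\<^sup>2 / 2)"

definition theta2 ::
    "'a::euclidean_space \<Rightarrow> 'a \<Rightarrow> 'a operator \<Rightarrow> 'a operator \<Rightarrow> ereal" where
  "theta2 x y A B = (INF J\<in>couplings A B. lower_generator J c2 (x, y))"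

definition optimal_markov_coupling ::
    "'a::euclidean_space operator \<Rightarrow> 'a operator \<Rightarrow> ('a \<times> 'a) operator \<Rightarrow> bool" where
  "optimal_markov_coupling A B J \<longleftrightarrow> J \<in> couplings A B \<and> c2 \<in> extended_domain J \<and>
     (\<forall>x y. ereal (extended_generator J c2 (x, y)) = theta2 x y A B)"

definition optimal_levy_coupling ::
    "'a::euclidean_space operator \<Rightarrow> 'a operator \<Rightarrow> ('a \<times> 'a) operator \<Rightarrow> bool" where
  "optimal_levy_coupling A B J \<longleftrightarrow> optimal_markov_coupling A B J \<and> J \<in> levy_generators"

text \<open>
  For \<open>A\<close> and \<open>B\<close> in \<open>levy_generators2\<close> the value \<open>theta2 0 0 A B\<close> is finite and nonnegative,
  since \<open>c2\<close> vanishes at the origin and the independent coupling has finite second moments.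
\<close>

definition wasserstein_generator_metric ::
    "'a::euclidean_space operator \<Rightarrow> 'a operator \<Rightarrow> real" where
  "wasserstein_generator_metric A B =
     sqrt ((norm (mean_vector A - mean_vector B))\<^sup>2 / 2 + real_of_ereal (theta2 0 0 A B))"

section \<open>Levy processes\<close>

definition cadlag :: "(real \<Rightarrow> 'a::topological_space) \<Rightarrow> bool" where
  "cadlag f \<longleftrightarrow> (\<forall>t\<ge>0. (f \<longlongrightarrow> f t) (at_right t)) \<and> (\<forall>t>0. \<exists>l. (f \<longlongrightarrow> l) (at_left t))"

text \<open>Levy processes indexed by \<open>t \<ge> 0\<close> and started at \<open>0\<close>.\<close>

definition levy_process ::
    "'w measure \<Rightarrow> (real \<Rightarrow> 'w \<Rightarrow> 'a::euclidean_space) \<Rightarrow> bool" where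
  "levy_process M Z \<longleftrightarrow> prob_space M \<and>
     (\<forall>t\<ge>0. Z t \<in> borel_measurable M) \<and>
     (AE \<omega> in M. Z 0 \<omega> = 0) \<and>
     (\<forall>n t. 0 \<le> t 0 \<and> mono_on {..n} t \<longrightarrow>
        prob_space.indep_vars M (\<lambda>_. borel) (\<lambda>i \<omega>. Z (t (Suc i)) \<omega> - Z (t i) \<omega>) {..<n::nat}) \<and>
     (\<forall>s t. 0 \<le> s \<and> s \<le> t \<longrightarrow>
        distr M borel (\<lambda>\<omega>. Z t \<omega> - Z s \<omega>) = distr M borel (Z (t - s))) \<and>
     (\<forall>\<omega>\<in>space M. cadlag (\<lambda>t. Z t \<omega>))"

text \<open>
  The process started at \<open>z\<close> is \<open>z + Z\<close>, so the second conjunct says that \<open>exp (t A)\<close> is the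
  transition semigroup of \<open>Z\<close>.
\<close>

definition levy_process_with_generator ::
    "'w measure \<Rightarrow> (real \<Rightarrow> 'w \<Rightarrow> 'a::euclidean_space) \<Rightarrow> 'a operator \<Rightarrow> bool" where
  "levy_process_with_generator M Z A \<longleftrightarrow> levy_process M Z \<and>
     (\<forall>t\<ge>0. \<forall>z. kernel A t z = distr M borel (\<lambda>\<omega>. z + Z t \<omega>))"

end

theory Submission
  imports Defs "HOL-Real_Asymp.Real_Asymp"
begin

text \<open>
  The difference \<open>D = X - Y\<close> is itself a Levy process, and the theorem is a maximal inequality for it.
  By optimality the cost \<open>c2\<close> is in the extended domain of the coupling, and its derivative at time
  \<open>0\<close> and at the origin is the transport derivative. Hence \<open>E|D\<^sub>h|\<^sup>2 / h\<close> tends to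
  \<open>v = 2 \<theta>\<close> with \<open>\<theta> = theta2 0 0 A B\<close>. If \<open>m\<close> denotes the difference of the mean
  vectors, then \<open>E D\<^sub>1 = m\<close> and the squared metric is \<open>(|m|\<^sup>2 + v) / 2\<close>.

  In terms of \<open>v\<close> and the centred process \<open>N\<^sub>t = D\<^sub>t - t m\<close> the second bound reads
  \<open>E sup |N|\<^sup>2 \<le> 2 T v = 2 E|N\<^sub>T|\<^sup>2\<close>. Doob's inequality would give the factor \<open>4\<close>. The factor \<open>2\<close>
  comes from the independence of the increments: for partial sums \<open>S\<^sub>k\<close> of independent centred
  real variables the one-sided maximum satisfies \<open>E (max\<^sub>k S\<^sub>k)\<^sup>2 \<le> E S\<^sub>n\<^sup>2\<close>, the maximum including
  \<open>S\<^sub>0 = 0\<close> (\<open>suffix_max_second_moment\<close>). One applies it to \<open>S\<close> and \<open>-S\<close>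
  (\<open>max_partial_sum_second_moment\<close>), on dyadic grids that exhaust \<open>[0,T]\<close> by right continuity
  (\<open>levy_maximal_inequality\<close>). The first bound follows from the second by
  \<open>|D\<^sub>t|\<^sup>2 \<le> 2 |N\<^sub>t|\<^sup>2 + 2 t\<^sup>2 |m|\<^sup>2\<close> (\<open>levy_maximal_inequality_drift\<close>).

  It remains to identify \<open>E D\<^sub>1\<close> with \<open>m\<close>, for which \<open>X\<^sub>1\<close> and \<open>Y\<^sub>1\<close> must be integrable
  separately. The marginals of a coupling are the given kernels
  (\<open>coupling_marginals\<close>). That these have finite second moments has to be read off from the action
  of the generators on smooth functions of compact support
  (\<open>levy_generators2_second_moment\<close>): a rescaled bump function yields truncations of \<open>|x|\<^sup>2\<close> that
  satisfy a Lyapunov condition uniformly in the truncation level.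
\<close>

section \<open>Maximal inequality for sums of independent centred variables\<close>

text \<open>
  For \<open>k \<le> n\<close> this is the maximum of \<open>0\<close> and of the sums of initial segments of the last \<open>k\<close> of the numbers
  \<open>x 0, \<dots>, x (n - 1)\<close>. The recursion (Lindley's, for waiting times in a queue) prepends one summand
  at a time: either nothing is taken, or the new summand is taken together with the best
  continuation.
\<close>

primrec suffix_max :: "nat \<Rightarrow> (nat \<Rightarrow> real) \<Rightarrow> nat \<Rightarrow> real" where
  "suffix_max n x 0 = 0"
| "suffix_max n x (Suc k) = max 0 (x (n - Suc k) + suffix_max n x k)"

lemma sum_le_suffix_max:
  assumes "k \<le> n" "j \<le> k"
  shows "sum x {n - k..<n - k + j} \<le> suffix_max n x k"
  using assms
proof (induction k arbitrary: j)
  case (Suc k)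
  show ?case
  proof (cases j)
    case (Suc i)
    have "{n - Suc k..<n - Suc k + j} = insert (n - Suc k) {n - k..<n - k + i}"
      using Suc.prems Suc by auto
    then have "sum x {n - Suc k..<n - Suc k + j} = x (n - Suc k) + sum x {n - k..<n - k + i}"
      using Suc.prems by simp
    also have "\<dots> \<le> x (n - Suc k) + suffix_max n x k"
      using Suc.IH[of i] Suc.prems Suc by simp
    finally show ?thesis by simp
  qed simp
qed simp

lemma suffix_max_restrict:
  assumes "{n - k..<n} \<subseteq> I" "k \<le> n"
  shows "suffix_max n (restrict x I) k = suffix_max n x k"
  using assms
proof (induction k)
  case (Suc k)
  from Suc.prems have "n - Suc k \<in> I" by auto
  moreover have "{n - k..<n} \<subseteq> I" using Suc.prems(1) by (rule order_trans[rotated]) (use Suc.prems(2) in auto)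
  ultimately show ?case using Suc by simp
qed simp

lemma measurable_suffix_max:
  assumes "{n - k..<n} \<subseteq> I" "k \<le> n"
  shows "(\<lambda>x. suffix_max n x k) \<in> borel_measurable (PiM I (\<lambda>_. borel))"
  using assms
proof (induction k)
  case (Suc k)
  from Suc.prems have "n - Suc k \<in> I" by auto
  moreover have "{n - k..<n} \<subseteq> I" using Suc.prems(1) by (rule order_trans[rotated]) (use Suc.prems(2) in auto)
  ultimately show ?case using Suc by simp
qed simp

context prob_space
begin

lemma square_norm_integrable_imp_integrable:
  fixes X :: "'a \<Rightarrow> 'b::euclidean_space"
  assumes "random_variable borel X" "integrable M (\<lambda>\<omega>. (norm (X \<omega>))\<^sup>2)"
  shows "integrable M X"
proof -
  have "random_variable borel (\<lambda>\<omega>. norm (X \<omega>))"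
    using assms(1) by measurable
  then have "integrable M (\<lambda>\<omega>. norm (X \<omega>))"
    using assms(2) by (rule square_integrable_imp_integrable)
  then show ?thesis
    by (rule integrable_norm_cancel[OF _ assms(1)])
qed

text \<open>
  Since \<open>(max 0 u)\<^sup>2 \<le> u\<^sup>2\<close>, one step of the recursion replaces \<open>R\<close> by a variable whose square is at
  most \<open>(\<xi> + R)\<^sup>2\<close>. The new summand \<open>\<xi>\<close> is centred and independent of \<open>R\<close>, so the cross term
  has expectation zero and second moments just add up. This is where building the partial sums from
  the last summand backwards pays: the running maximum enters the square of the next step without a
  loss, so there is no constant in the inequality.
\<close>

lemma suffix_max_second_moment:
  fixes \<xi> :: "nat \<Rightarrow> 'a \<Rightarrow> real"
  assumes indep: "indep_vars (\<lambda>_. borel) \<xi> {..<n}"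
    and sq: "\<And>i. i < n \<Longrightarrow> integrable M (\<lambda>\<omega>. (\<xi> i \<omega>)\<^sup>2)"
    and mean: "\<And>i. i < n \<Longrightarrow> expectation (\<xi> i) = 0"
    and "k \<le> n"
  shows "integrable M (\<lambda>\<omega>. (suffix_max n (\<lambda>i. \<xi> i \<omega>) k)\<^sup>2) \<and>
    expectation (\<lambda>\<omega>. (suffix_max n (\<lambda>i. \<xi> i \<omega>) k)\<^sup>2)
      \<le> (\<Sum>i=n - k..<n. expectation (\<lambda>\<omega>. (\<xi> i \<omega>)\<^sup>2))"
  using \<open>k \<le> n\<close>
proof (induction k)
  case (Suc k)
  define m where "m = n - Suc k"
  have m: "m < n" "{n - Suc k..<n} = insert m {n - k..<n}" "m \<notin> {n - k..<n}"
    using Suc.prems by (auto simp: m_def)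
  have rv: "random_variable borel (\<xi> i)" if "i < n" for i
    using indep that by (auto simp: indep_vars_def)
  let ?R = "\<lambda>\<omega>. suffix_max n (\<lambda>i. \<xi> i \<omega>) k"
  have "indep_var borel ((\<lambda>x. x m) \<circ> (\<lambda>\<omega>. restrict (\<lambda>i. \<xi> i \<omega>) {m}))
      borel ((\<lambda>x. suffix_max n x k) \<circ> (\<lambda>\<omega>. restrict (\<lambda>i. \<xi> i \<omega>) {n - k..<n}))"
    using m Suc.prems
    by (intro indep_var_compose[OF indep_var_restrict[OF indep]] measurable_suffix_max) auto
  also have "(\<lambda>x. x m) \<circ> (\<lambda>\<omega>. restrict (\<lambda>i. \<xi> i \<omega>) {m}) = \<xi> m"
    by auto
  also have "(\<lambda>x. suffix_max n x k) \<circ> (\<lambda>\<omega>. restrict (\<lambda>i. \<xi> i \<omega>) {n - k..<n}) = ?R"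
    using Suc.prems by (auto simp: fun_eq_iff suffix_max_restrict simp del: restrict_apply)
  finally have ind: "indep_var borel (\<xi> m) borel ?R" .
  have IH: "integrable M (\<lambda>\<omega>. (?R \<omega>)\<^sup>2)"
    "expectation (\<lambda>\<omega>. (?R \<omega>)\<^sup>2) \<le> (\<Sum>i=n - k..<n. expectation (\<lambda>\<omega>. (\<xi> i \<omega>)\<^sup>2))"
    using Suc by auto
  have rvR: "random_variable borel ?R" using ind by (rule indep_var_rv2)
  have R: "integrable M ?R"
    using rvR IH(1) by (rule square_integrable_imp_integrable)
  have X: "integrable M (\<xi> m)"
    using rv[OF m(1)] sq[OF m(1)] by (rule square_integrable_imp_integrable)
  have XR: "integrable M (\<lambda>\<omega>. \<xi> m \<omega> * ?R \<omega>)"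
    by (rule indep_var_integrable[OF ind X R])
  have "expectation (\<lambda>\<omega>. \<xi> m \<omega> * ?R \<omega>) = 0"
    using indep_var_lebesgue_integral[OF ind X R] mean[OF m(1)] by simp
  moreover have sq_sum: "(\<lambda>\<omega>. (\<xi> m \<omega> + ?R \<omega>)\<^sup>2) = (\<lambda>\<omega>. (\<xi> m \<omega>)\<^sup>2 + 2 * (\<xi> m \<omega> * ?R \<omega>) + (?R \<omega>)\<^sup>2)"
    by (auto simp: power2_eq_square algebra_simps)
  ultimately have E: "expectation (\<lambda>\<omega>. (\<xi> m \<omega> + ?R \<omega>)\<^sup>2) =
      expectation (\<lambda>\<omega>. (\<xi> m \<omega>)\<^sup>2) + expectation (\<lambda>\<omega>. (?R \<omega>)\<^sup>2)"
    using XR IH sq[OF m(1)] by simp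
  have int: "integrable M (\<lambda>\<omega>. (\<xi> m \<omega> + ?R \<omega>)\<^sup>2)"
    unfolding sq_sum using XR IH sq[OF m(1)] by simp
  have le: "(max 0 (\<xi> m \<omega> + ?R \<omega>))\<^sup>2 \<le> (\<xi> m \<omega> + ?R \<omega>)\<^sup>2" for \<omega>
    by (auto simp: max_def)
  have int': "integrable M (\<lambda>\<omega>. (max 0 (\<xi> m \<omega> + ?R \<omega>))\<^sup>2)"
    by (rule Bochner_Integration.integrable_bound[OF int]) (use rvR rv[OF m(1)] le in auto)
  have "expectation (\<lambda>\<omega>. (max 0 (\<xi> m \<omega> + ?R \<omega>))\<^sup>2) \<le> expectation (\<lambda>\<omega>. (\<xi> m \<omega> + ?R \<omega>)\<^sup>2)"
    by (rule integral_mono[OF int' int le])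
  with int' E IH(2) m show ?case
    by (simp add: m_def[symmetric])
qed simp

text \<open>
  In each coordinate \<open>|S\<^sub>k|\<close> is at most the running maximum of \<open>S\<close> or that of \<open>-S\<close>, and each of the
  two has second moment at most that of \<open>S\<^sub>n\<close>. This gives the factor \<open>2\<close>, where Doob's inequality
  for general martingales has \<open>4\<close>.
\<close>

lemma max_partial_sum_second_moment:
  fixes \<xi> :: "nat \<Rightarrow> 'a \<Rightarrow> 'b::euclidean_space"
  assumes indep: "indep_vars (\<lambda>_. borel) \<xi> {..<n}"
    and sq: "\<And>i. i < n \<Longrightarrow> integrable M (\<lambda>\<omega>. (norm (\<xi> i \<omega>))\<^sup>2)"
    and mean: "\<And>i. i < n \<Longrightarrow> expectation (\<xi> i) = 0"
  shows "(\<integral>\<^sup>+\<omega>. (SUP k\<in>{..n}. ennreal ((norm (\<Sum>i<k. \<xi> i \<omega>))\<^sup>2)) \<partial>M)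
    \<le> ennreal (2 * (\<Sum>i<n. expectation (\<lambda>\<omega>. (norm (\<xi> i \<omega>))\<^sup>2)))"
proof -
  have rv: "random_variable borel (\<xi> i)" if "i < n" for i
    using indep that by (auto simp: indep_vars_def)
  have int: "integrable M (\<xi> i)" if "i < n" for i
    by (rule square_norm_integrable_imp_integrable) (use rv sq that in auto)
  have sqb: "integrable M (\<lambda>\<omega>. (\<xi> i \<omega> \<bullet> b)\<^sup>2)" if "i < n" "b \<in> Basis" for i b
  proof (rule Bochner_Integration.integrable_bound[OF sq[OF that(1)]])
    show "AE \<omega> in M. norm ((\<xi> i \<omega> \<bullet> b)\<^sup>2) \<le> norm ((norm (\<xi> i \<omega>))\<^sup>2)"
    proof (rule AE_I2)
      fix \<omega>
      have "\<bar>\<xi> i \<omega> \<bullet> b\<bar>\<^sup>2 \<le> (norm (\<xi> i \<omega>))\<^sup>2"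
        by (intro power_mono Basis_le_norm that abs_ge_zero)
      then show "norm ((\<xi> i \<omega> \<bullet> b)\<^sup>2) \<le> norm ((norm (\<xi> i \<omega>))\<^sup>2)"
        by simp
    qed
  qed (use rv[OF that(1)] in auto)
  define U where "U b \<omega> = suffix_max n (\<lambda>i. \<xi> i \<omega> \<bullet> b) n" for b \<omega>
  have U: "integrable M (\<lambda>\<omega>. (U (s *\<^sub>R b) \<omega>)\<^sup>2)"
    "expectation (\<lambda>\<omega>. (U (s *\<^sub>R b) \<omega>)\<^sup>2) \<le> (\<Sum>i<n. expectation (\<lambda>\<omega>. (\<xi> i \<omega> \<bullet> b)\<^sup>2))"
    if b: "b \<in> Basis" and s: "s \<in> {-1, 1}" for b s
  proof -
    have "indep_vars (\<lambda>_. borel) (\<lambda>i \<omega>. \<xi> i \<omega> \<bullet> (s *\<^sub>R b)) {..<n}"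
      by (rule indep_vars_compose2[OF indep]) auto
    moreover have "integrable M (\<lambda>\<omega>. (\<xi> i \<omega> \<bullet> (s *\<^sub>R b))\<^sup>2)" if "i < n" for i
      using sqb[OF that b] s by (auto simp: power_mult_distrib)
    moreover have "expectation (\<lambda>\<omega>. \<xi> i \<omega> \<bullet> (s *\<^sub>R b)) = 0" if "i < n" for i
      using integral_inner_left[OF int[OF that], of "s *\<^sub>R b"] mean[OF that] by simp
    ultimately have *: "integrable M (\<lambda>\<omega>. (U (s *\<^sub>R b) \<omega>)\<^sup>2) \<and>
      expectation (\<lambda>\<omega>. (U (s *\<^sub>R b) \<omega>)\<^sup>2)
        \<le> (\<Sum>i=n - n..<n. expectation (\<lambda>\<omega>. (\<xi> i \<omega> \<bullet> (s *\<^sub>R b))\<^sup>2))"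
      unfolding U_def by (intro suffix_max_second_moment) auto
    have "s * s = 1" using s by auto
    then have "(\<xi> i \<omega> \<bullet> (s *\<^sub>R b))\<^sup>2 = (\<xi> i \<omega> \<bullet> b)\<^sup>2" for i \<omega>
      by (simp add: power_mult_distrib power2_eq_square)
    with * show "integrable M (\<lambda>\<omega>. (U (s *\<^sub>R b) \<omega>)\<^sup>2)"
      "expectation (\<lambda>\<omega>. (U (s *\<^sub>R b) \<omega>)\<^sup>2) \<le> (\<Sum>i<n. expectation (\<lambda>\<omega>. (\<xi> i \<omega> \<bullet> b)\<^sup>2))"
      by (auto simp: atLeast0LessThan)
  qed
  \<comment> \<open>The pointwise majorant: both one-sided running maxima of every coordinate.\<close>
  let ?V = "\<lambda>\<omega>. \<Sum>b\<in>Basis. (U (1 *\<^sub>R b) \<omega>)\<^sup>2 + (U ((-1) *\<^sub>R b) \<omega>)\<^sup>2"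
  have bound: "(norm (\<Sum>i<k. \<xi> i \<omega>))\<^sup>2 \<le> ?V \<omega>" if "k \<le> n" for k \<omega>
  proof -
    let ?S = "\<Sum>i<k. \<xi> i \<omega>"
    have S: "?S \<bullet> c \<le> U c \<omega>" for c
      using sum_le_suffix_max[of n n k "\<lambda>i. \<xi> i \<omega> \<bullet> c"] that
      by (simp add: U_def inner_sum_left atLeast0LessThan)
    have "(?S \<bullet> b)\<^sup>2 \<le> (U (1 *\<^sub>R b) \<omega>)\<^sup>2 + (U ((-1) *\<^sub>R b) \<omega>)\<^sup>2" for b
    proof (cases "0 \<le> ?S \<bullet> b")
      case True
      then have "(?S \<bullet> b)\<^sup>2 \<le> (U (1 *\<^sub>R b) \<omega>)\<^sup>2"
        using S[of "1 *\<^sub>R b"] by (intro power_mono) auto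
      then show ?thesis by (simp add: add_increasing2)
    next
      case False
      then have "(- (?S \<bullet> b))\<^sup>2 \<le> (U ((-1) *\<^sub>R b) \<omega>)\<^sup>2"
        using S[of "(-1) *\<^sub>R b"] by (intro power_mono) auto
      then show ?thesis by (simp add: add_increasing)
    qed
    then have "(\<Sum>b\<in>Basis. (?S \<bullet> b)\<^sup>2) \<le> ?V \<omega>"
      by (rule sum_mono)
    moreover have "(norm ?S)\<^sup>2 = (\<Sum>b\<in>Basis. (?S \<bullet> b)\<^sup>2)"
      unfolding power2_norm_eq_inner by (subst euclidean_inner) (simp add: power2_eq_square)
    ultimately show ?thesis by simp
  qed
  have V: "integrable M ?V" using U(1)[of _ 1] U(1)[of _ "-1"] by simp
  have "(\<integral>\<^sup>+\<omega>. (SUP k\<in>{..n}. ennreal ((norm (\<Sum>i<k. \<xi> i \<omega>))\<^sup>2)) \<partial>M) \<le> (\<integral>\<^sup>+\<omega>. ennreal (?V \<omega>) \<partial>M)"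
    by (intro nn_integral_mono SUP_least ennreal_leI bound) auto
  also have "\<dots> = ennreal (expectation ?V)"
    using V by (intro nn_integral_eq_integral) (auto intro!: sum_nonneg)
  also have "expectation ?V = (\<Sum>b\<in>Basis. expectation (\<lambda>\<omega>. (U (1 *\<^sub>R b) \<omega>)\<^sup>2) + expectation (\<lambda>\<omega>. (U ((-1) *\<^sub>R b) \<omega>)\<^sup>2))"
    using U(1)[of _ 1] U(1)[of _ "-1"]
    by (subst Bochner_Integration.integral_sum) (auto intro!: sum.cong Bochner_Integration.integral_add)
  also have "\<dots> \<le> (\<Sum>b\<in>Basis. 2 * (\<Sum>i<n. expectation (\<lambda>\<omega>. (\<xi> i \<omega> \<bullet> b)\<^sup>2)))"
    using U(2)[of _ 1] U(2)[of _ "-1"] by (intro sum_mono) force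
  also have "\<dots> = 2 * (\<Sum>i<n. \<Sum>b\<in>Basis. expectation (\<lambda>\<omega>. (\<xi> i \<omega> \<bullet> b)\<^sup>2))"
    by (subst sum_distrib_left[symmetric], subst sum.swap) simp
  also have "\<dots> = 2 * (\<Sum>i<n. expectation (\<lambda>\<omega>. (norm (\<xi> i \<omega>))\<^sup>2))"
  proof -
    have "(\<Sum>b\<in>Basis. expectation (\<lambda>\<omega>. (\<xi> i \<omega> \<bullet> b)\<^sup>2)) = expectation (\<lambda>\<omega>. (norm (\<xi> i \<omega>))\<^sup>2)"
      if "i < n" for i
      unfolding power2_norm_eq_inner
      by (subst euclidean_inner, subst Bochner_Integration.integral_sum)
        (use sqb that in \<open>auto simp: power2_eq_square\<close>)
    then show ?thesis by simp
  qed
  finally show ?thesis by (simp add: ennreal_leI)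
qed

end

section \<open>Maximal inequalities for Levy processes\<close>

lemma levy_processD:
  assumes "levy_process M Z"
  shows "prob_space M" "t \<ge> 0 \<Longrightarrow> Z t \<in> borel_measurable M" "AE \<omega> in M. Z 0 \<omega> = 0"
    "0 \<le> s \<Longrightarrow> s \<le> t \<Longrightarrow> distr M borel (\<lambda>\<omega>. Z t \<omega> - Z s \<omega>) = distr M borel (Z (t - s))"
    "0 \<le> \<tau> 0 \<Longrightarrow> mono_on {..n} \<tau> \<Longrightarrow>
      prob_space.indep_vars M (\<lambda>_. borel) (\<lambda>i \<omega>. Z (\<tau> (Suc i)) \<omega> - Z (\<tau> i) \<omega>) {..<n}"
    "\<omega> \<in> space M \<Longrightarrow> cadlag (\<lambda>t. Z t \<omega>)"
  using assms by (auto simp: levy_process_def)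

lemma levy_process_linear_image:
  fixes f :: "'a::euclidean_space \<Rightarrow> 'b::euclidean_space"
  assumes Z: "levy_process M Z" and f: "bounded_linear f"
  shows "levy_process M (\<lambda>t \<omega>. f (Z t \<omega>))"
proof -
  interpret prob_space M by (rule levy_processD[OF Z])
  interpret f: bounded_linear f by (rule f)
  have cont: "continuous_on UNIV f" by (rule f.continuous_on[OF continuous_on_id])
  have fm[measurable]: "f \<in> borel_measurable borel"
    by (rule borel_measurable_continuous_onI[OF cont])
  have Zm: "Z t \<in> borel_measurable M" if "t \<ge> 0" for t
    using levy_processD(2)[OF Z that] .
  show ?thesis
    unfolding levy_process_def
  proof (intro conjI allI impI ballI, goal_cases)
    case 1
    show ?case by unfold_locales
  next
    case (2 t)
    then show ?case using Zm[OF 2] by measurable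
  next
    case 3
    show ?case using levy_processD(3)[OF Z] by eventually_elim (simp add: f.zero)
  next
    case (4 n \<tau>)
    then have "indep_vars (\<lambda>_. borel) (\<lambda>i \<omega>. f (Z (\<tau> (Suc i)) \<omega> - Z (\<tau> i) \<omega>)) {..<n}"
      by (intro indep_vars_compose2[OF levy_processD(5)[OF Z]]) auto
    then show ?case by (simp add: f.diff)
  next
    case (5 s t)
    then have [measurable]: "Z t \<in> borel_measurable M" "Z s \<in> borel_measurable M"
      "Z (t - s) \<in> borel_measurable M"
      using Zm by auto
    have "distr M borel (\<lambda>\<omega>. f (Z t \<omega>) - f (Z s \<omega>)) = distr (distr M borel (\<lambda>\<omega>. Z t \<omega> - Z s \<omega>)) borel f"
      by (subst distr_distr) (auto simp: comp_def f.diff)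
    also have "\<dots> = distr (distr M borel (Z (t - s))) borel f"
      using levy_processD(4)[OF Z] 5 by simp
    also have "\<dots> = distr M borel (\<lambda>\<omega>. f (Z (t - s) \<omega>))"
      by (subst distr_distr) (auto simp: comp_def)
    finally show ?case .
  next
    case (6 \<omega>)
    note c = levy_processD(6)[OF Z 6]
    show ?case
      unfolding cadlag_def
    proof (intro conjI allI impI, goal_cases)
      case (1 t)
      then show ?case using c by (intro f.tendsto) (simp add: cadlag_def)
    next
      case (2 t)
      then obtain l where "((\<lambda>t. Z t \<omega>) \<longlongrightarrow> l) (at_left t)" using c by (auto simp: cadlag_def)
      then have "((\<lambda>t. f (Z t \<omega>)) \<longlongrightarrow> f l) (at_left t)" by (rule f.tendsto)
      then show ?case by (rule exI)
    qed
  qed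
qed

lemma levy_process_subtract_drift:
  fixes m :: "'a::euclidean_space"
  assumes Z: "levy_process M Z"
  shows "levy_process M (\<lambda>t \<omega>. Z t \<omega> - t *\<^sub>R m)"
proof -
  interpret prob_space M by (rule levy_processD[OF Z])
  have Zm: "Z t \<in> borel_measurable M" if "t \<ge> 0" for t
    using levy_processD(2)[OF Z that] .
  show ?thesis
    unfolding levy_process_def
  proof (intro conjI allI impI ballI, goal_cases)
    case 1
    show ?case by unfold_locales
  next
    case (2 t)
    then show ?case using Zm[OF 2] by measurable
  next
    case 3
    show ?case using levy_processD(3)[OF Z] by eventually_elim simp
  next
    case (4 n \<tau>)
    then have "indep_vars (\<lambda>_. borel)
        (\<lambda>i \<omega>. (\<lambda>x. x - (\<tau> (Suc i) - \<tau> i) *\<^sub>R m) (Z (\<tau> (Suc i)) \<omega> - Z (\<tau> i) \<omega>)) {..<n}"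
      by (intro indep_vars_compose2[OF levy_processD(5)[OF Z]]) auto
    moreover have "x - (u - v) *\<^sub>R m = x + v *\<^sub>R m - u *\<^sub>R m" for x u v
      by (simp add: algebra_simps)
    ultimately show ?case by (simp add: algebra_simps)
  next
    case (5 s t)
    then have [measurable]: "Z t \<in> borel_measurable M" "Z s \<in> borel_measurable M"
      "Z (t - s) \<in> borel_measurable M"
      using Zm by auto
    have "distr M borel (\<lambda>\<omega>. (Z t \<omega> - t *\<^sub>R m) - (Z s \<omega> - s *\<^sub>R m))
        = distr (distr M borel (\<lambda>\<omega>. Z t \<omega> - Z s \<omega>)) borel (\<lambda>x. x - (t - s) *\<^sub>R m)"
      by (subst distr_distr) (auto simp: comp_def algebra_simps)
    also have "\<dots> = distr (distr M borel (Z (t - s))) borel (\<lambda>x. x - (t - s) *\<^sub>R m)"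
      using levy_processD(4)[OF Z] 5 by simp
    also have "\<dots> = distr M borel (\<lambda>\<omega>. Z (t - s) \<omega> - (t - s) *\<^sub>R m)"
      by (subst distr_distr) (auto simp: comp_def)
    finally show ?case .
  next
    case (6 \<omega>)
    note c = levy_processD(6)[OF Z 6]
    show ?case
      unfolding cadlag_def
    proof (intro conjI allI impI, goal_cases)
      case (1 t)
      then have "((\<lambda>t. Z t \<omega>) \<longlongrightarrow> Z t \<omega>) (at_right t)" using c by (simp add: cadlag_def)
      then show ?case by (intro tendsto_intros)
    next
      case (2 t)
      then obtain l where "((\<lambda>t. Z t \<omega>) \<longlongrightarrow> l) (at_left t)" using c by (auto simp: cadlag_def)
      then have "((\<lambda>t. Z t \<omega> - t *\<^sub>R m) \<longlongrightarrow> l - t *\<^sub>R m) (at_left t)" by (intro tendsto_intros)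
      then show ?case by blast
    qed
  qed
qed

lemma levy_increment_expectation:
  fixes g :: "'a::euclidean_space \<Rightarrow> 'b::{banach,second_countable_topology}"
  assumes Z: "levy_process M Z" and g: "g \<in> borel_measurable borel" and "0 \<le> s" "s \<le> t"
  shows "(\<integral>\<omega>. g (Z t \<omega> - Z s \<omega>) \<partial>M) = (\<integral>\<omega>. g (Z (t - s) \<omega>) \<partial>M)"
    and "integrable M (\<lambda>\<omega>. g (Z t \<omega> - Z s \<omega>)) \<longleftrightarrow> integrable M (\<lambda>\<omega>. g (Z (t - s) \<omega>))"
proof -
  have [measurable]: "Z t \<in> borel_measurable M" "Z s \<in> borel_measurable M"
      "Z (t - s) \<in> borel_measurable M"
    using levy_processD(2)[OF Z] assms by auto
  note [measurable] = g
  have *: "distr M borel (\<lambda>\<omega>. Z t \<omega> - Z s \<omega>) = distr M borel (Z (t - s))"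
    using levy_processD(4)[OF Z] assms by simp
  have "(\<integral>\<omega>. g (Z t \<omega> - Z s \<omega>) \<partial>M) = (\<integral>x. g x \<partial>distr M borel (\<lambda>\<omega>. Z t \<omega> - Z s \<omega>))"
    by (rule integral_distr[symmetric]) auto
  also have "\<dots> = (\<integral>\<omega>. g (Z (t - s) \<omega>) \<partial>M)"
    unfolding * by (rule integral_distr) auto
  finally show "(\<integral>\<omega>. g (Z t \<omega> - Z s \<omega>) \<partial>M) = (\<integral>\<omega>. g (Z (t - s) \<omega>) \<partial>M)" .
  have "integrable M (\<lambda>\<omega>. g (Z t \<omega> - Z s \<omega>)) \<longleftrightarrow> integrable (distr M borel (\<lambda>\<omega>. Z t \<omega> - Z s \<omega>)) g"
    by (rule integrable_distr_eq[symmetric]) auto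
  also have "\<dots> \<longleftrightarrow> integrable M (\<lambda>\<omega>. g (Z (t - s) \<omega>))"
    unfolding * by (rule integrable_distr_eq) auto
  finally show "integrable M (\<lambda>\<omega>. g (Z t \<omega> - Z s \<omega>)) \<longleftrightarrow> integrable M (\<lambda>\<omega>. g (Z (t - s) \<omega>))" .
qed

lemma levy_grid_maximal_inequality:
  fixes N :: "real \<Rightarrow> 'w \<Rightarrow> 'a::euclidean_space"
  assumes N: "levy_process M N" and h: "0 \<le> h"
    and sq: "integrable M (\<lambda>\<omega>. (norm (N h \<omega>))\<^sup>2)"
    and mean: "(\<integral>\<omega>. N h \<omega> \<partial>M) = 0"
  shows "(\<integral>\<^sup>+\<omega>. (SUP k\<in>{..n}. ennreal ((norm (N (real k * h) \<omega>))\<^sup>2)) \<partial>M)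
    \<le> ennreal (2 * (real n * (\<integral>\<omega>. (norm (N h \<omega>))\<^sup>2 \<partial>M)))"
proof -
  interpret prob_space M by (rule levy_processD[OF N])
  define \<xi> where "\<xi> i \<omega> = N (real (Suc i) * h) \<omega> - N (real i * h) \<omega>" for i \<omega>
  have step: "real (Suc i) * h - real i * h = h" "0 \<le> real i * h" "real i * h \<le> real (Suc i) * h" for i
    using h by (auto simp: algebra_simps)
  have mono: "mono_on {..n} (\<lambda>i. real i * h)"
    using h by (auto intro!: mono_onI mult_right_mono)
  have "(\<integral>\<^sup>+\<omega>. (SUP k\<in>{..n}. ennreal ((norm (N (real k * h) \<omega>))\<^sup>2)) \<partial>M)
      = (\<integral>\<^sup>+\<omega>. (SUP k\<in>{..n}. ennreal ((norm (\<Sum>i<k. \<xi> i \<omega>))\<^sup>2)) \<partial>M)"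
  proof (rule nn_integral_cong_AE)
    show "AE \<omega> in M. (SUP k\<in>{..n}. ennreal ((norm (N (real k * h) \<omega>))\<^sup>2))
        = (SUP k\<in>{..n}. ennreal ((norm (\<Sum>i<k. \<xi> i \<omega>))\<^sup>2))"
      using levy_processD(3)[OF N]
    proof eventually_elim
      case (elim \<omega>)
      have "(\<Sum>i<k. \<xi> i \<omega>) = N (real k * h) \<omega>" for k
        unfolding \<xi>_def using elim by (subst sum_lessThan_telescope) simp
      then show ?case by simp
    qed
  qed
  also have "\<dots> \<le> ennreal (2 * (\<Sum>i<n. expectation (\<lambda>\<omega>. (norm (\<xi> i \<omega>))\<^sup>2)))"
  proof (rule max_partial_sum_second_moment)
    show "indep_vars (\<lambda>_. borel) \<xi> {..<n}"
      using levy_processD(5)[OF N _ mono] by (simp add: \<xi>_def[abs_def])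
    show "integrable M (\<lambda>\<omega>. (norm (\<xi> i \<omega>))\<^sup>2)" for i
      unfolding \<xi>_def
      by (subst levy_increment_expectation(2)[OF N, where g="\<lambda>x. (norm x)\<^sup>2"])
        (use step sq in auto)
    show "expectation (\<xi> i) = 0" for i
      unfolding \<xi>_def[abs_def]
      using levy_increment_expectation(1)[OF N, where g="\<lambda>x. x", OF _ step(2,3)] mean
      unfolding step(1) by simp
  qed
  also have "(\<Sum>i<n. expectation (\<lambda>\<omega>. (norm (\<xi> i \<omega>))\<^sup>2)) = real n * expectation (\<lambda>\<omega>. (norm (N h \<omega>))\<^sup>2)"
  proof -
    have "expectation (\<lambda>\<omega>. (norm (\<xi> i \<omega>))\<^sup>2) = expectation (\<lambda>\<omega>. (norm (N h \<omega>))\<^sup>2)" for i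
      unfolding \<xi>_def
      using levy_increment_expectation(1)[OF N, where g="\<lambda>x. (norm x)\<^sup>2", OF _ step(2,3)]
      unfolding step(1) by simp
    then show ?thesis by simp
  qed
  finally show ?thesis .
qed

text \<open>
  A time \<open>t < T\<close> is the limit from the right of the grid points next after it, so right
  continuity carries a bound on the grids over to \<open>t\<close>; the end point \<open>T\<close> lies on every grid.
  The right-hand side is a countable supremum, which is what makes the supremum measurable.
\<close>

lemma cadlag_SUP_eq_dyadic_SUP:
  fixes f :: "real \<Rightarrow> 'a::euclidean_space"
  assumes "cadlag f" "T \<ge> 0"
  shows "(SUP t\<in>{0..T}. ennreal ((norm (f t))\<^sup>2))
    = (SUP n. SUP k\<in>{..2 ^ n}. ennreal ((norm (f (real k * (T / 2 ^ n))))\<^sup>2))" (is "_ = ?S")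
proof (rule antisym)
  show "?S \<le> (SUP t\<in>{0..T}. ennreal ((norm (f t))\<^sup>2))"
  proof (intro SUP_least)
    fix n k :: nat assume "k \<in> {..2 ^ n}"
    then have "real k \<le> 2 ^ n" by (simp flip: of_nat_le_iff)
    then have "real k * T \<le> 2 ^ n * T" using assms by (intro mult_right_mono)
    then have "real k * (T / 2 ^ n) \<in> {0..T}"
      using assms by (simp add: field_simps)
    then show "ennreal ((norm (f (real k * (T / 2 ^ n))))\<^sup>2) \<le> (SUP t\<in>{0..T}. ennreal ((norm (f t))\<^sup>2))"
      by (rule SUP_upper)
  qed
  show "(SUP t\<in>{0..T}. ennreal ((norm (f t))\<^sup>2)) \<le> ?S"
  proof (rule SUP_least)
    fix t assume t: "t \<in> {0..T}"
    have grid: "ennreal ((norm (f (real k * (T / 2 ^ n))))\<^sup>2) \<le> ?S" if "k \<le> 2 ^ n" for k n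
      by (rule SUP_upper2[of n], simp, rule SUP_upper2[of k]) (use that in auto)
    show "ennreal ((norm (f t))\<^sup>2) \<le> ?S"
    proof (cases "t = T")
      case True
      then show ?thesis using grid[of "2 ^ 0" 0] by simp
    next
      case False
      with t have "t < T" "T > 0" by auto
      define k where "k n = nat (\<lfloor>t * 2 ^ n / T\<rfloor> + 1)" for n :: nat
      define u where "u n = real (k n) * (T / 2 ^ n)" for n
      have rk: "real (k n) = of_int \<lfloor>t * 2 ^ n / T\<rfloor> + 1" for n
        using t \<open>T > 0\<close> by (simp add: k_def)
      have kn: "t * 2 ^ n / T < real (k n)" "real (k n) \<le> t * 2 ^ n / T + 1" for n
        unfolding rk by linarith+
      have u: "t < u n" "u n \<le> t + T / 2 ^ n" for n
        using kn[of n] \<open>T > 0\<close> unfolding u_def by (auto simp: field_simps)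
      have k_le: "k n \<le> 2 ^ n" for n
      proof -
        have "t * 2 ^ n / T < 2 ^ n" using \<open>t < T\<close> \<open>T > 0\<close> by (simp add: field_simps)
        then have "\<lfloor>t * 2 ^ n / T\<rfloor> < 2 ^ n" by (simp add: floor_less_iff)
        then show ?thesis unfolding k_def using t \<open>T > 0\<close> by (simp add: nat_le_iff)
      qed
      have "(\<lambda>n. t + T * (1 / 2) ^ n) \<longlonglongrightarrow> t + T * 0"
        by (intro tendsto_intros LIMSEQ_realpow_zero) auto
      then have "(\<lambda>n. t + T / 2 ^ n) \<longlonglongrightarrow> t" by (simp add: power_divide)
      then have "u \<longlonglongrightarrow> t"
        by (rule tendsto_sandwich[OF _ _ tendsto_const, rotated -1]) (use u in \<open>auto simp: less_imp_le\<close>)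
      moreover have "u n \<in> {t<..}" "u n \<noteq> t" for n
        using u(1)[of n] by auto
      ultimately have "filterlim u (at_right t) sequentially"
        by (auto simp: filterlim_at)
      moreover have "(f \<longlongrightarrow> f t) (at_right t)" using assms t by (simp add: cadlag_def)
      ultimately have "(\<lambda>n. f (u n)) \<longlonglongrightarrow> f t" by (rule filterlim_compose[rotated])
      then have "(\<lambda>n. ennreal ((norm (f (u n)))\<^sup>2)) \<longlonglongrightarrow> ennreal ((norm (f t))\<^sup>2)"
        by (intro tendsto_intros tendsto_ennrealI)
      then show ?thesis
        by (rule LIMSEQ_le_const2) (use grid[OF k_le] in \<open>auto simp: u_def\<close>)
    qed
  qed
qed

lemma borel_measurable_levy_SUP:
  assumes N: "levy_process M N" and T: "T \<ge> 0"
  shows "(\<lambda>\<omega>. SUP t\<in>{0..T}. ennreal ((norm (N t \<omega>))\<^sup>2)) \<in> borel_measurable M"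
proof -
  have [measurable]: "N (real k * (T / 2 ^ n)) \<in> borel_measurable M" for k n
    using levy_processD(2)[OF N] T by simp
  have "(\<lambda>\<omega>. SUP n. SUP k\<in>{..2 ^ n}. ennreal ((norm (N (real k * (T / 2 ^ n)) \<omega>))\<^sup>2)) \<in> borel_measurable M"
    by measurable
  then show ?thesis
    by (rule measurable_cong[THEN iffD1, rotated])
      (rule cadlag_SUP_eq_dyadic_SUP[OF levy_processD(6)[OF N] T, symmetric])
qed

text \<open>
  On the dyadic grid of mesh \<open>h = T / 2\<^sup>n\<close> the bound is \<open>2 \<cdot> 2\<^sup>n E|N\<^sub>h|\<^sup>2 = 2 T E|N\<^sub>h|\<^sup>2 / h\<close>, which
  tends to \<open>2 T v\<close>; the maxima over the grids increase to the supremum over \<open>[0,T]\<close>.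
\<close>

theorem levy_maximal_inequality:
  fixes N :: "real \<Rightarrow> 'w \<Rightarrow> 'a::euclidean_space"
  assumes N: "levy_process M N"
    and sq: "\<And>t. t \<ge> 0 \<Longrightarrow> integrable M (\<lambda>\<omega>. (norm (N t \<omega>))\<^sup>2)"
    and mean: "\<And>t. t \<ge> 0 \<Longrightarrow> (\<integral>\<omega>. N t \<omega> \<partial>M) = 0"
    and v: "((\<lambda>h. (\<integral>\<omega>. (norm (N h \<omega>))\<^sup>2 \<partial>M) / h) \<longlongrightarrow> v) (at_right 0)"
    and T: "T \<ge> 0"
  shows "(\<integral>\<^sup>+\<omega>. (SUP t\<in>{0..T}. ennreal ((norm (N t \<omega>))\<^sup>2)) \<partial>M) \<le> ennreal (2 * T * v)"
proof -
  interpret prob_space M by (rule levy_processD[OF N])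
  have Nm[measurable]: "N (real k * (T / 2 ^ n)) \<in> borel_measurable M" for k n
    using levy_processD(2)[OF N] T by simp
  define G where "G n \<omega> = (SUP k\<in>{..2 ^ n}. ennreal ((norm (N (real k * (T / 2 ^ n)) \<omega>))\<^sup>2))" for n :: nat and \<omega>
  define w where "w n = (\<integral>\<omega>. (norm (N (T / 2 ^ n) \<omega>))\<^sup>2 \<partial>M)" for n :: nat
  have Gm: "G n \<in> borel_measurable M" for n
    unfolding G_def[abs_def] by measurable
  have "incseq G"
  proof (rule incseq_SucI, rule le_funI)
    fix n \<omega>
    show "G n \<omega> \<le> G (Suc n) \<omega>"
      unfolding G_def
    proof (rule SUP_least)
      fix k :: nat assume "k \<in> {..2 ^ n}"
      then show "ennreal ((norm (N (real k * (T / 2 ^ n)) \<omega>))\<^sup>2)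
          \<le> (SUP k\<in>{..2 ^ Suc n}. ennreal ((norm (N (real k * (T / 2 ^ Suc n)) \<omega>))\<^sup>2))"
        by (intro SUP_upper2[of "2 * k"]) auto
    qed
  qed
  have "(\<integral>\<^sup>+\<omega>. (SUP t\<in>{0..T}. ennreal ((norm (N t \<omega>))\<^sup>2)) \<partial>M) = (\<integral>\<^sup>+\<omega>. (SUP n. G n \<omega>) \<partial>M)"
    unfolding G_def
    by (intro nn_integral_cong cadlag_SUP_eq_dyadic_SUP T levy_processD(6)[OF N])
  also have "\<dots> = (SUP n. \<integral>\<^sup>+\<omega>. G n \<omega> \<partial>M)"
    by (rule nn_integral_monotone_convergence_SUP[OF \<open>incseq G\<close> Gm])
  also have "\<dots> \<le> ennreal (2 * T * v)"
  proof (rule LIMSEQ_le)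
    show "(\<lambda>n. \<integral>\<^sup>+\<omega>. G n \<omega> \<partial>M) \<longlonglongrightarrow> (SUP n. \<integral>\<^sup>+\<omega>. G n \<omega> \<partial>M)"
      using \<open>incseq G\<close> by (intro LIMSEQ_SUP) (auto simp: incseq_def le_fun_def intro!: nn_integral_mono)
    show "\<exists>n0. \<forall>n\<ge>n0. (\<integral>\<^sup>+\<omega>. G n \<omega> \<partial>M) \<le> ennreal (2 * (2 ^ n * w n))"
    proof (intro exI allI impI)
      fix n :: nat
      show "(\<integral>\<^sup>+\<omega>. G n \<omega> \<partial>M) \<le> ennreal (2 * (2 ^ n * w n))"
        using levy_grid_maximal_inequality[OF N _ sq mean, of "T / 2 ^ n" "2 ^ n"] T
        by (simp add: G_def w_def)
    qed
    have "(\<lambda>n. 2 * (2 ^ n * w n)) \<longlonglongrightarrow> 2 * T * v"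
    proof (cases "T = 0")
      case True
      have "(\<integral>\<omega>. (norm (N 0 \<omega>))\<^sup>2 \<partial>M) = (\<integral>\<omega>. 0 \<partial>M)"
        by (rule integral_cong_AE)
          (use levy_processD(2)[OF N, of 0] levy_processD(3)[OF N] in auto)
      then have "w n = 0" for n using True by (simp add: w_def)
      then show ?thesis using True by simp
    next
      case False
      with T have "T > 0" by simp
      have "(\<lambda>n. T * (1 / 2) ^ n) \<longlonglongrightarrow> T * 0"
        by (intro tendsto_intros LIMSEQ_realpow_zero) auto
      then have "filterlim (\<lambda>n. T / 2 ^ n) (at_right 0) sequentially"
        using \<open>T > 0\<close> by (auto simp: filterlim_at power_divide)
      from filterlim_compose[OF v this]
      have "(\<lambda>n. w n / (T / 2 ^ n)) \<longlonglongrightarrow> v" by (simp add: w_def)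
      then have "(\<lambda>n. 2 * T * (w n / (T / 2 ^ n))) \<longlonglongrightarrow> 2 * T * v"
        by (intro tendsto_intros)
      then show ?thesis using \<open>T > 0\<close> by (simp add: field_simps)
    qed
    then show "(\<lambda>n. ennreal (2 * (2 ^ n * w n))) \<longlonglongrightarrow> ennreal (2 * T * v)"
      by (rule tendsto_ennrealI)
  qed
  finally show ?thesis .
qed

text \<open>
  Cauchy's functional equation: additivity determines \<open>f\<close> on the multiples of \<open>1/n\<close>, and \<open>T\<close> exceeds
  such a multiple by some \<open>r\<^sub>n \<in> (0, 1/n]\<close>, on which \<open>f\<close> vanishes in the limit.
\<close>

lemma additive_vanishing_at_0_imp_linear:
  fixes f :: "real \<Rightarrow> 'a::real_normed_vector"
  assumes add: "\<And>s t. 0 \<le> s \<Longrightarrow> 0 \<le> t \<Longrightarrow> f (s + t) = f s + f t"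
    and lim: "(f \<longlongrightarrow> 0) (at_right 0)" and "0 \<le> T"
  shows "f T = T *\<^sub>R f 1"
proof (cases "T = 0")
  case True
  then show ?thesis using add[of 0 0] by simp
next
  case False
  with \<open>0 \<le> T\<close> have "T > 0" by simp
  have mult: "f (real k * t) = real k *\<^sub>R f t" if "0 \<le> t" for k t
  proof (induction k)
    case 0
    then show ?case using add[of 0 0] by simp
  next
    case (Suc k)
    then show ?case using add[of t "real k * t"] that by (simp add: algebra_simps)
  qed
  \<comment> \<open>Ceiling minus one rather than floor, since the limit at \<open>0\<close> requires \<open>r n > 0\<close>.\<close>
  define r where "r n = T - real (nat (\<lceil>T * real (Suc n)\<rceil> - 1)) / real (Suc n)" for n
  have r: "0 < r n" "r n \<le> 1 / real (Suc n)" "f T = (T - r n) *\<^sub>R f 1 + f (r n)" for n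
  proof -
    define k where "k = nat (\<lceil>T * real (Suc n)\<rceil> - 1)"
    have "0 < \<lceil>T * real (Suc n)\<rceil>" using \<open>T > 0\<close> by simp
    then have k: "real k = of_int \<lceil>T * real (Suc n)\<rceil> - 1"
      by (simp add: k_def)
    have "real k < T * real (Suc n)" "T * real (Suc n) \<le> real k + 1"
      unfolding k by linarith+
    then have bounds: "real k / real (Suc n) < T" "T \<le> (real k + 1) / real (Suc n)"
      by (simp_all add: pos_divide_less_eq pos_le_divide_eq del: of_nat_Suc)
    have rn: "r n = T - real k / real (Suc n)" by (simp add: r_def k_def)
    show "0 < r n" "r n \<le> 1 / real (Suc n)"
      using bounds unfolding rn add_divide_distrib by linarith+
    have "f 1 = real (Suc n) *\<^sub>R f (1 / real (Suc n))"
      using mult[of "1 / real (Suc n)" "Suc n"] by simp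
    then have "f (1 / real (Suc n)) = (1 / real (Suc n)) *\<^sub>R f 1"
      by simp
    moreover have "f (real k / real (Suc n)) = real k *\<^sub>R f (1 / real (Suc n))"
      using mult[of "1 / real (Suc n)" k] by simp
    ultimately have "f (real k / real (Suc n)) = (real k / real (Suc n)) *\<^sub>R f 1"
      by simp
    moreover have "f T = f (real k / real (Suc n)) + f (r n)"
      using add[of "real k / real (Suc n)" "r n"] \<open>0 < r n\<close> by (simp add: rn)
    ultimately show "f T = (T - r n) *\<^sub>R f 1 + f (r n)" by (simp add: rn)
  qed
  have r0: "r \<longlonglongrightarrow> 0"
    by (rule tendsto_sandwich[OF _ _ tendsto_const LIMSEQ_inverse_real_of_nat])
      (use r(1,2) in \<open>auto simp: less_imp_le inverse_eq_divide\<close>)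
  moreover have "r n \<in> {0<..}" "r n \<noteq> 0" for n using r(1)[of n] by auto
  ultimately have "filterlim r (at_right 0) sequentially"
    by (auto simp: filterlim_at)
  then have fr: "(\<lambda>n. f (r n)) \<longlonglongrightarrow> 0" by (rule filterlim_compose[OF lim])
  have "(\<lambda>n. (T - r n) *\<^sub>R f 1 + f (r n)) \<longlonglongrightarrow> (T - 0) *\<^sub>R f 1 + 0"
    by (intro tendsto_intros r0 fr)
  then have "(\<lambda>n. f T) \<longlonglongrightarrow> T *\<^sub>R f 1" by (simp flip: r(3))
  then show ?thesis by (simp add: LIMSEQ_const_iff)
qed

lemma (in prob_space) norm_expectation_le_second_moment:
  fixes X :: "'a \<Rightarrow> 'b::euclidean_space"
  assumes "random_variable borel X" "integrable M (\<lambda>\<omega>. (norm (X \<omega>))\<^sup>2)"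
  shows "(norm (expectation X))\<^sup>2 \<le> expectation (\<lambda>\<omega>. (norm (X \<omega>))\<^sup>2)"
proof -
  have X: "integrable M X" by (rule square_norm_integrable_imp_integrable[OF assms])
  have "(norm (expectation X))\<^sup>2 \<le> (expectation (\<lambda>\<omega>. norm (X \<omega>)))\<^sup>2"
    by (intro power_mono integral_norm_bound norm_ge_zero)
  also have "\<dots> \<le> expectation (\<lambda>\<omega>. (norm (X \<omega>))\<^sup>2)"
    using variance_positive[of "\<lambda>\<omega>. norm (X \<omega>)"] variance_eq[of "\<lambda>\<omega>. norm (X \<omega>)"] X assms(2)
    by simp
  finally show ?thesis .
qed

text \<open>
  Means of independent stationary increments add up, and \<open>|E D\<^sub>h|\<^sup>2 \<le> E|D\<^sub>h|\<^sup>2 = O(h)\<close> gives the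
  regularity that Cauchy's equation needs.
\<close>

lemma levy_mean_linear:
  fixes D :: "real \<Rightarrow> 'w \<Rightarrow> 'a::euclidean_space"
  assumes D: "levy_process M D"
    and sq: "\<And>t. t \<ge> 0 \<Longrightarrow> integrable M (\<lambda>\<omega>. (norm (D t \<omega>))\<^sup>2)"
    and v: "((\<lambda>h. (\<integral>\<omega>. (norm (D h \<omega>))\<^sup>2 \<partial>M) / h) \<longlongrightarrow> v) (at_right 0)"
    and "t \<ge> 0"
  shows "(\<integral>\<omega>. D t \<omega> \<partial>M) = t *\<^sub>R (\<integral>\<omega>. D 1 \<omega> \<partial>M)"
proof (rule additive_vanishing_at_0_imp_linear[OF _ _ \<open>t \<ge> 0\<close>])
  interpret prob_space M by (rule levy_processD[OF D])
  have int: "integrable M (D t)" if "t \<ge> 0" for t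
    by (rule square_norm_integrable_imp_integrable[OF levy_processD(2)[OF D that] sq[OF that]])
  show "expectation (D (s + t)) = expectation (D s) + expectation (D t)" if "0 \<le> s" "0 \<le> t" for s t
  proof -
    have "expectation (D t) = expectation (\<lambda>\<omega>. D (s + t) \<omega> - D s \<omega>)"
      using levy_increment_expectation(1)[OF D, of "\<lambda>x. x" s "s + t"] that by simp
    also have "\<dots> = expectation (D (s + t)) - expectation (D s)"
      using int that by simp
    finally show ?thesis by simp
  qed
  show "((\<lambda>t. expectation (D t)) \<longlongrightarrow> 0) (at_right 0)"
  proof (rule tendsto_norm_zero_cancel, rule tendsto_sandwich[OF _ _ tendsto_const])
    have pos: "eventually (\<lambda>h::real. h > 0) (at_right 0)"
      by (rule eventually_at_right_less)
    show "\<forall>\<^sub>F h in at_right 0. norm (expectation (D h))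
        \<le> sqrt (h * (expectation (\<lambda>\<omega>. (norm (D h \<omega>))\<^sup>2) / h))"
      using pos
    proof eventually_elim
      case (elim h)
      then show ?case
        using norm_expectation_le_second_moment[OF levy_processD(2)[OF D, of h] sq[of h]]
        by (intro real_le_rsqrt) simp
    qed
    have "((\<lambda>h. sqrt (h * (expectation (\<lambda>\<omega>. (norm (D h \<omega>))\<^sup>2) / h))) \<longlongrightarrow> sqrt (0 * v)) (at_right 0)"
      by (intro tendsto_intros v)
    then show "((\<lambda>h. sqrt (h * (expectation (\<lambda>\<omega>. (norm (D h \<omega>))\<^sup>2) / h))) \<longlongrightarrow> 0) (at_right 0)"
      by simp
  qed simp
qed

text \<open>
  Split \<open>D\<^sub>t = N\<^sub>t + t m\<close> with \<open>m = E D\<^sub>1\<close> and use \<open>|D\<^sub>t|\<^sup>2 \<le> 2|N\<^sub>t|\<^sup>2 + 2 t\<^sup>2 |m|\<^sup>2\<close>. The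
  centred part \<open>N\<close> has the same rate \<open>v\<close>, because \<open>E|D\<^sub>h|\<^sup>2\<close> and \<open>E|N\<^sub>h|\<^sup>2\<close> differ by \<open>h\<^sup>2 |m|\<^sup>2\<close>.
\<close>

theorem levy_maximal_inequality_drift:
  fixes D :: "real \<Rightarrow> 'w \<Rightarrow> 'a::euclidean_space"
  assumes D: "levy_process M D"
    and sq: "\<And>t. t \<ge> 0 \<Longrightarrow> integrable M (\<lambda>\<omega>. (norm (D t \<omega>))\<^sup>2)"
    and v: "((\<lambda>h. (\<integral>\<omega>. (norm (D h \<omega>))\<^sup>2 \<partial>M) / h) \<longlongrightarrow> v) (at_right 0)"
    and T: "T \<ge> 0"
  shows "(\<integral>\<^sup>+\<omega>. (SUP t\<in>{0..T}. ennreal ((norm (D t \<omega>))\<^sup>2)) \<partial>M)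
    \<le> ennreal (4 * T * v + 2 * T\<^sup>2 * (norm (\<integral>\<omega>. D 1 \<omega> \<partial>M))\<^sup>2)"
proof -
  interpret prob_space M by (rule levy_processD[OF D])
  define m where "m = expectation (D 1)"
  define N where "N t \<omega> = D t \<omega> - t *\<^sub>R m" for t \<omega>
  have N: "levy_process M N"
    unfolding N_def[abs_def] by (rule levy_process_subtract_drift[OF D])
  have int: "integrable M (D t)" if "t \<ge> 0" for t
    by (rule square_norm_integrable_imp_integrable[OF levy_processD(2)[OF D that] sq[OF that]])
  have mean: "expectation (D t) = t *\<^sub>R m" if "t \<ge> 0" for t
    unfolding m_def by (rule levy_mean_linear[OF D sq v that])
  have Nsq: "(norm (N t \<omega>))\<^sup>2 = (norm (D t \<omega>))\<^sup>2 - 2 * t * (D t \<omega> \<bullet> m) + t\<^sup>2 * (norm m)\<^sup>2" for t \<omega>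
    unfolding N_def power2_norm_eq_inner
    by (simp add: inner_diff_left inner_diff_right inner_commute power2_eq_square)
  have sqN: "integrable M (\<lambda>\<omega>. (norm (N t \<omega>))\<^sup>2)"
    and EN: "expectation (\<lambda>\<omega>. (norm (N t \<omega>))\<^sup>2) = expectation (\<lambda>\<omega>. (norm (D t \<omega>))\<^sup>2) - t\<^sup>2 * (norm m)\<^sup>2"
    if "t \<ge> 0" for t
  proof -
    have "integrable M (\<lambda>\<omega>. D t \<omega> \<bullet> m)" using int[OF that] by simp
    moreover have "expectation (\<lambda>\<omega>. D t \<omega> \<bullet> m) = t * (norm m)\<^sup>2"
      using integral_inner_left[OF int[OF that], of m] mean[OF that]
      by (simp add: power2_norm_eq_inner)
    ultimately show "integrable M (\<lambda>\<omega>. (norm (N t \<omega>))\<^sup>2)"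
      "expectation (\<lambda>\<omega>. (norm (N t \<omega>))\<^sup>2) = expectation (\<lambda>\<omega>. (norm (D t \<omega>))\<^sup>2) - t\<^sup>2 * (norm m)\<^sup>2"
      unfolding Nsq using sq[OF that] by (simp_all add: prob_space power2_eq_square)
  qed
  have "((\<lambda>h. expectation (\<lambda>\<omega>. (norm (D h \<omega>))\<^sup>2) / h - h * (norm m)\<^sup>2) \<longlongrightarrow> v - 0 * (norm m)\<^sup>2) (at_right 0)"
    by (intro tendsto_intros v)
  moreover have "\<forall>\<^sub>F h in at_right 0. expectation (\<lambda>\<omega>. (norm (D h \<omega>))\<^sup>2) / h - h * (norm m)\<^sup>2
      = expectation (\<lambda>\<omega>. (norm (N h \<omega>))\<^sup>2) / h"
    using eventually_at_right_less[of "0::real"]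
    by eventually_elim (simp add: EN diff_divide_distrib, simp add: power2_eq_square)
  ultimately have vN: "((\<lambda>h. expectation (\<lambda>\<omega>. (norm (N h \<omega>))\<^sup>2) / h) \<longlongrightarrow> v) (at_right 0)"
    by (simp add: tendsto_cong)
  have "v \<ge> 0"
    by (rule tendsto_lowerbound[OF v])
      (auto intro!: eventually_mono[OF eventually_at_right_less[of "0::real"]])
  let ?S = "\<lambda>\<omega>. SUP t\<in>{0..T}. ennreal ((norm (N t \<omega>))\<^sup>2)"
  have "expectation (N t) = 0" if "t \<ge> 0" for t
    unfolding N_def[abs_def] using int[OF that] mean[OF that] by (simp add: prob_space)
  then have IN: "(\<integral>\<^sup>+\<omega>. ?S \<omega> \<partial>M) \<le> ennreal (2 * T * v)"
    by (intro levy_maximal_inequality[OF N sqN _ vN T])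
  have le: "(SUP t\<in>{0..T}. ennreal ((norm (D t \<omega>))\<^sup>2)) \<le> 2 * ?S \<omega> + ennreal (2 * T\<^sup>2 * (norm m)\<^sup>2)" for \<omega>
  proof (rule SUP_least)
    fix t assume t: "t \<in> {0..T}"
    have "(norm (D t \<omega>))\<^sup>2 \<le> (norm (N t \<omega>) + norm (t *\<^sub>R m))\<^sup>2"
      using norm_triangle_ineq[of "N t \<omega>" "t *\<^sub>R m"] by (intro power_mono) (auto simp: N_def)
    also have "\<dots> \<le> 2 * (norm (N t \<omega>))\<^sup>2 + 2 * (norm (t *\<^sub>R m))\<^sup>2"
      using sum_squares_bound[of "norm (N t \<omega>)" "norm (t *\<^sub>R m)"]
      by (simp add: power2_sum)
    also have "2 * (norm (t *\<^sub>R m))\<^sup>2 \<le> 2 * T\<^sup>2 * (norm m)\<^sup>2"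
      using t by (auto simp: power_mult_distrib intro!: mult_right_mono power_mono)
    finally have "ennreal ((norm (D t \<omega>))\<^sup>2) \<le> ennreal (2 * (norm (N t \<omega>))\<^sup>2 + 2 * T\<^sup>2 * (norm m)\<^sup>2)"
      by (intro ennreal_leI) simp
    also have "\<dots> = 2 * ennreal ((norm (N t \<omega>))\<^sup>2) + ennreal (2 * T\<^sup>2 * (norm m)\<^sup>2)"
      by (subst ennreal_plus) (auto simp: ennreal_mult)
    also have "\<dots> \<le> 2 * ?S \<omega> + ennreal (2 * T\<^sup>2 * (norm m)\<^sup>2)"
      using t by (intro add_right_mono mult_left_mono SUP_upper) auto
    finally show "ennreal ((norm (D t \<omega>))\<^sup>2) \<le> 2 * ?S \<omega> + ennreal (2 * T\<^sup>2 * (norm m)\<^sup>2)" .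
  qed
  note [measurable] = borel_measurable_levy_SUP[OF N T]
  have "(\<integral>\<^sup>+\<omega>. (SUP t\<in>{0..T}. ennreal ((norm (D t \<omega>))\<^sup>2)) \<partial>M)
      \<le> (\<integral>\<^sup>+\<omega>. 2 * ?S \<omega> + ennreal (2 * T\<^sup>2 * (norm m)\<^sup>2) \<partial>M)"
    by (intro nn_integral_mono le)
  also have "\<dots> = 2 * (\<integral>\<^sup>+\<omega>. ?S \<omega> \<partial>M) + ennreal (2 * T\<^sup>2 * (norm m)\<^sup>2)"
    by (subst nn_integral_add) (auto simp: nn_integral_cmult emeasure_space_1)
  also have "\<dots> \<le> 2 * ennreal (2 * T * v) + ennreal (2 * T\<^sup>2 * (norm m)\<^sup>2)"
    by (intro add_right_mono mult_left_mono IN) auto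
  also have "\<dots> = ennreal (4 * T * v + 2 * T\<^sup>2 * (norm m)\<^sup>2)"
    using T \<open>v \<ge> 0\<close> ennreal_mult[of 2 "2 * T * v"]
    by (subst ennreal_plus) (auto simp: mult.assoc)
  finally show ?thesis by (simp add: m_def)
qed

section \<open>A smooth bump function\<close>

text \<open>
  The derivatives of the flat function \<open>exp (-1/s)\<close> are combinations of the functions
  \<open>s\<^sup>-\<^sup>n exp (-1/s)\<close>, extended by \<open>0\<close> to \<open>s \<le> 0\<close>.
\<close>

definition flat_exp :: "nat \<Rightarrow> real \<Rightarrow> real" where
  "flat_exp n s = (if s > 0 then exp (- 1 / s) / s ^ n else 0)"

lemma has_real_derivative_flat_exp:
  "(flat_exp n has_real_derivative flat_exp (n + 2) s - real n * flat_exp (n + 1) s) (at s)"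
proof -
  consider "s > 0" | "s < 0" | "s = 0" by linarith
  then show ?thesis
  proof cases
    case 1
    have "((\<lambda>s. exp (- 1 / s) / s ^ n) has_real_derivative
        flat_exp (n + 2) s - real n * flat_exp (n + 1) s) (at s)"
      using 1 by (auto intro!: derivative_eq_intros simp: flat_exp_def field_simps power2_eq_square)
        (cases n, auto simp: field_simps)
    moreover have "\<forall>\<^sub>F x in nhds s. flat_exp n x = exp (- 1 / x) / x ^ n"
      using eventually_nhds_in_open[of "{0<..}" s] 1
      by (auto simp: flat_exp_def elim!: eventually_mono)
    ultimately show ?thesis
      by (subst DERIV_cong_ev[OF refl _ refl]) auto
  next
    case 2
    have "\<forall>\<^sub>F x in nhds s. flat_exp n x = 0"
      using eventually_nhds_in_open[of "{..<0}" s] 2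
      by (auto simp: flat_exp_def elim!: eventually_mono)
    then show ?thesis
      using 2 by (subst DERIV_cong_ev[OF refl _ refl]) (auto simp: flat_exp_def)
  next
    case 3
    have "((\<lambda>y. (flat_exp n y - flat_exp n 0) / (y - 0)) \<longlongrightarrow> 0) (at 0)"
    proof (rule filterlim_split_at)
      have "((\<lambda>y::real. exp (- 1 / y) / y ^ n / y) \<longlongrightarrow> 0) (at_right 0)"
        by real_asymp
      then show "((\<lambda>y. (flat_exp n y - flat_exp n 0) / (y - 0)) \<longlongrightarrow> 0) (at_right 0)"
        by (rule Lim_transform_eventually)
          (auto simp: flat_exp_def intro!: eventually_mono[OF eventually_at_right_less[of "0::real"]])
      have "\<forall>\<^sub>F y in at_left (0::real). (flat_exp n y - flat_exp n 0) / (y - 0) = 0"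
        by (auto simp: flat_exp_def eventually_at_filter intro!: always_eventually)
      then show "((\<lambda>y. (flat_exp n y - flat_exp n 0) / (y - 0)) \<longlongrightarrow> 0) (at_left 0)"
        by (rule tendsto_eventually)
    qed
    then show ?thesis using 3 by (simp add: has_field_derivative_iff flat_exp_def)
  qed
qed

text \<open>
  A class of functions that contains a bump function supported in the unit ball and that is closed
  under directional derivatives, so that all its members are smooth.
\<close>

inductive_set flat_class :: "('a::euclidean_space \<Rightarrow> real) set" where
  flat_exp: "(\<lambda>x. flat_exp n (1 - x \<bullet> x)) \<in> flat_class"
| add: "f \<in> flat_class \<Longrightarrow> g \<in> flat_class \<Longrightarrow> (\<lambda>x. f x + g x) \<in> flat_class"
| scale: "f \<in> flat_class \<Longrightarrow> (\<lambda>x. c * f x) \<in> flat_class"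
| linear: "f \<in> flat_class \<Longrightarrow> (\<lambda>x. (x \<bullet> v) * f x) \<in> flat_class"

lemma flat_class_derivative:
  assumes "f \<in> flat_class"
  shows "\<exists>f'. (\<forall>x. (f has_derivative f' x) (at x)) \<and> (\<forall>v. (\<lambda>x. f' x v) \<in> flat_class)"
  using assms
proof induction
  case (flat_exp n)
  let ?d = "\<lambda>s. flat_exp (n + 2) s - real n * flat_exp (n + 1) s"
  have "((\<lambda>x. flat_exp n (1 - x \<bullet> x)) has_derivative (\<lambda>v. ?d (1 - x \<bullet> x) * (- (x \<bullet> v + v \<bullet> x)))) (at x)" for x :: 'a
    by (rule has_derivative_compose[where f="\<lambda>x. 1 - x \<bullet> x" and g="flat_exp n", OF _ has_real_derivative_flat_exp[unfolded has_field_derivative_def]])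
      (auto intro!: derivative_eq_intros)
  moreover have "(\<lambda>x. ?d (1 - x \<bullet> x) * (- (x \<bullet> v + v \<bullet> x))) \<in> flat_class" for v :: 'a
  proof -
    have "(\<lambda>x. - 2 * ((x \<bullet> v) * (flat_exp (n + 2) (1 - x \<bullet> x) + (- real n) * flat_exp (n + 1) (1 - x \<bullet> x)))) \<in> flat_class"
      by (intro flat_class.intros)
    also have "(\<lambda>x. - 2 * ((x \<bullet> v) * (flat_exp (n + 2) (1 - x \<bullet> x) + (- real n) * flat_exp (n + 1) (1 - x \<bullet> x))))
        = (\<lambda>x. ?d (1 - x \<bullet> x) * (- (x \<bullet> v + v \<bullet> x)))"
      by (auto simp: fun_eq_iff inner_commute algebra_simps)
    finally show ?thesis .
  qed
  ultimately show ?case by (intro exI[of _ "\<lambda>x v. ?d (1 - x \<bullet> x) * (- (x \<bullet> v + v \<bullet> x))"]) auto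
next
  case (add f g)
  then obtain f' g' where "\<forall>x. (f has_derivative f' x) (at x)" "\<forall>v. (\<lambda>x. f' x v) \<in> flat_class"
    "\<forall>x. (g has_derivative g' x) (at x)" "\<forall>v. (\<lambda>x. g' x v) \<in> flat_class"
    by auto
  then show ?case
    by (intro exI[of _ "\<lambda>x v. f' x v + g' x v"]) (auto intro!: has_derivative_add flat_class.intros)
next
  case (scale f c)
  then obtain f' where "\<forall>x. (f has_derivative f' x) (at x)" "\<forall>v. (\<lambda>x. f' x v) \<in> flat_class"
    by auto
  then show ?case
    by (intro exI[of _ "\<lambda>x v. c * f' x v"]) (auto intro!: has_derivative_mult_right flat_class.intros)
next
  case (linear f w)
  then obtain f' where f': "\<forall>x. (f has_derivative f' x) (at x)" "\<forall>v. (\<lambda>x. f' x v) \<in> flat_class"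
    by auto
  have "((\<lambda>x. (x \<bullet> w) * f x) has_derivative (\<lambda>v. (x \<bullet> w) * f' x v + (w \<bullet> v) * f x)) (at x)" for x
    by (rule derivative_eq_intros f'(1)[rule_format] refl | simp add: inner_commute)+
  then show ?case
    using f' linear.hyps
    by (intro exI[of _ "\<lambda>x v. (x \<bullet> w) * f' x v + (w \<bullet> v) * f x"]) (auto intro!: flat_class.intros)
qed

lemma Ck_flat_class:
  assumes "f \<in> flat_class"
  shows "Ck k f"
  using assms
proof (induction k arbitrary: f)
  case 0
  then obtain f' where "\<And>x. (f has_derivative f' x) (at x)" using flat_class_derivative by blast
  then show ?case
    by (auto simp: continuous_on_eq_continuous_at dest: has_derivative_continuous)
next
  case (Suc k)
  then obtain f' where f': "\<And>x. (f has_derivative f' x) (at x)" "\<And>v. (\<lambda>x. f' x v) \<in> flat_class"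
    using flat_class_derivative by blast
  have "frechet_derivative f (at x) = f' x" for x
    using frechet_derivative_at[OF f'(1)] by simp
  with f' Suc.IH show ?case
    by (auto simp: differentiable_on_def differentiable_def)
qed

lemma frechet_derivative_rescale:
  fixes f :: "'a::euclidean_space \<Rightarrow> 'b::euclidean_space"
  assumes "f differentiable_on UNIV"
  shows "(\<lambda>x. c *\<^sub>R f (r *\<^sub>R x)) differentiable_on UNIV"
    and "frechet_derivative (\<lambda>x. c *\<^sub>R f (r *\<^sub>R x)) (at x) v = (c * r) *\<^sub>R frechet_derivative f (at (r *\<^sub>R x)) v"
proof -
  have f: "(f has_derivative frechet_derivative f (at x)) (at x)" for x
    using assms by (simp add: differentiable_on_def frechet_derivative_works)
  have d: "((\<lambda>x. c *\<^sub>R f (r *\<^sub>R x)) has_derivative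
      (\<lambda>v. c *\<^sub>R frechet_derivative f (at (r *\<^sub>R x)) (r *\<^sub>R v))) (at x)" for x
    by (intro has_derivative_scaleR_right has_derivative_compose[where g=f and f="\<lambda>x. r *\<^sub>R x", OF _ f])
      (auto intro!: derivative_eq_intros)
  then show "(\<lambda>x. c *\<^sub>R f (r *\<^sub>R x)) differentiable_on UNIV"
    by (auto simp: differentiable_on_def differentiable_def)
  have "frechet_derivative f (at (r *\<^sub>R x)) (r *\<^sub>R v) = r *\<^sub>R frechet_derivative f (at (r *\<^sub>R x)) v"
    by (rule linear_cmul[OF has_derivative_linear[OF f]])
  then show "frechet_derivative (\<lambda>x. c *\<^sub>R f (r *\<^sub>R x)) (at x) v = (c * r) *\<^sub>R frechet_derivative f (at (r *\<^sub>R x)) v"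
    using frechet_derivative_at[OF d, of x] by (metis scaleR_scaleR)
qed

lemma Ck_rescale: "Ck k f \<Longrightarrow> Ck k (\<lambda>x. c * f (r *\<^sub>R x))"
proof (induction k arbitrary: f c)
  case 0
  then have "continuous_on UNIV f" by simp
  then have "continuous_on UNIV (\<lambda>x. f (r *\<^sub>R x))"
    by (rule continuous_on_compose2) (auto intro!: continuous_intros)
  then show ?case by (auto intro!: continuous_intros)
next
  case (Suc k)
  then have f: "f differentiable_on UNIV" by simp
  have "Ck k (\<lambda>x. (c * r) * frechet_derivative f (at (r *\<^sub>R x)) v)" for v
    using Suc.prems by (intro Suc.IH) simp
  then show ?case
    using frechet_derivative_rescale[OF f, of c r] by simp
qed

lemma gradient_rescale:
  assumes "f differentiable_on UNIV"
  shows "gradient (\<lambda>x. c * f (r *\<^sub>R x)) x = (c * r) *\<^sub>R gradient f (r *\<^sub>R x)"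
  using frechet_derivative_rescale(2)[OF assms, of c r x]
  by (simp add: gradient_def scaleR_sum_right mult.assoc)

lemma hessian_rescale:
  assumes "f differentiable_on UNIV" "gradient f differentiable_on UNIV"
  shows "hessian (\<lambda>x. c * f (r *\<^sub>R x)) x v = (c * r * r) *\<^sub>R hessian f (r *\<^sub>R x) v"
proof -
  have "gradient (\<lambda>x. c * f (r *\<^sub>R x)) = (\<lambda>x. (c * r) *\<^sub>R gradient f (r *\<^sub>R x))"
    using gradient_rescale[OF assms(1)] by (simp add: fun_eq_iff)
  then show ?thesis
    using frechet_derivative_rescale(2)[OF assms(2), of "c * r" r x v] by (simp add: hessian_def)
qed

lemma Ck_gradient_differentiable:
  assumes "Ck 2 f"
  shows "f differentiable_on UNIV" "gradient f differentiable_on UNIV"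
    "continuous_on UNIV (\<lambda>x. hessian f x v)"
proof -
  have f: "f differentiable_on UNIV"
    "(\<lambda>x. frechet_derivative f (at x) b) differentiable_on UNIV"
    "continuous_on UNIV (\<lambda>x. frechet_derivative (\<lambda>x. frechet_derivative f (at x) b) (at x) v)" for b v
    using assms by (simp_all add: numeral_2_eq_2)
  show "f differentiable_on UNIV" by (rule f)
  have "((\<lambda>x. frechet_derivative f (at x) b) has_derivative
      frechet_derivative (\<lambda>x. frechet_derivative f (at x) b) (at x)) (at x)" for b x
    using f(2) by (simp add: differentiable_on_def frechet_derivative_works)
  then have g: "(gradient f has_derivative
      (\<lambda>v. \<Sum>b\<in>Basis. frechet_derivative (\<lambda>x. frechet_derivative f (at x) b) (at x) v *\<^sub>R b)) (at x)" for x
    unfolding gradient_def[abs_def]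
    by (intro has_derivative_sum has_derivative_scaleR_left)
  then show "gradient f differentiable_on UNIV"
    by (auto simp: differentiable_on_def differentiable_def)
  have "hessian f x v = (\<Sum>b\<in>Basis. frechet_derivative (\<lambda>x. frechet_derivative f (at x) b) (at x) v *\<^sub>R b)" for x
    unfolding hessian_def frechet_derivative_at[OF g, symmetric] ..
  then show "continuous_on UNIV (\<lambda>x. hessian f x v)"
    by (simp add: continuous_intros f(3))
qed

lemma hessian_vanishes_outside_support:
  assumes "x \<notin> closure {x. f x \<noteq> 0}"
  shows "hessian f x v = 0"
proof -
  let ?U = "- closure {x. f x \<noteq> 0}"
  have U: "open ?U" by auto
  have 0: "f y = 0" if "y \<in> ?U" for y
    using that closure_subset[of "{x. f x \<noteq> 0}"] by auto
  have "(f has_derivative (\<lambda>_. 0)) (at y)" if "y \<in> ?U" for y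
    by (rule has_derivative_transform_within_open[OF has_derivative_const U that])
      (rule 0[symmetric])
  then have "frechet_derivative f (at y) = (\<lambda>_. 0)" if "y \<in> ?U" for y
    using frechet_derivative_at[symmetric] that by blast
  then have grad: "gradient f y = 0" if "y \<in> ?U" for y
    using that by (simp add: gradient_def)
  have "(gradient f has_derivative (\<lambda>_. 0)) (at x)"
  proof (rule has_derivative_transform_within_open[OF has_derivative_const U])
    show "x \<in> ?U" using assms by simp
  qed (rule grad[symmetric])
  then show "hessian f x v = 0"
    unfolding hessian_def by (simp add: frechet_derivative_at[symmetric])
qed

lemma hessian_bounded:
  fixes f :: "'a::euclidean_space \<Rightarrow> real"
  assumes "f \<in> test_functions"
  shows "\<exists>L\<ge>0. \<forall>x v. norm (hessian f x v) \<le> L * norm v"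
proof -
  have f: "Ck 2 f" "compact (closure {x. f x \<noteq> 0})"
    using assms by (auto simp: test_functions_def)
  note d = Ck_gradient_differentiable[OF f(1)]
  have lin: "linear (hessian f x)" for x
    unfolding hessian_def
    using d(2) by (intro has_derivative_linear[of "gradient f" _ "at x"])
      (simp add: differentiable_on_def frechet_derivative_works)
  have "\<exists>B. \<forall>x. norm (hessian f x b) \<le> B" for b
  proof -
    have "compact ((\<lambda>x. hessian f x b) ` closure {x. f x \<noteq> 0})"
      by (intro compact_continuous_image continuous_on_subset[OF d(3)] f) auto
    then obtain B where B: "\<And>x. x \<in> closure {x. f x \<noteq> 0} \<Longrightarrow> norm (hessian f x b) \<le> B"
      using compact_imp_bounded bounded_iff by (metis imageI)
    have "norm (hessian f x b) \<le> max 0 B" for x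
      using B[of x] hessian_vanishes_outside_support[of x f b] by (cases "x \<in> closure {x. f x \<noteq> 0}") auto
    then show ?thesis by blast
  qed
  then obtain B where B: "\<And>x b. norm (hessian f x b) \<le> B b" by metis
  show ?thesis
  proof (intro exI conjI allI)
    have B0: "0 \<le> B b" for b using B[of 0 b] norm_ge_zero order_trans by blast
    then show "0 \<le> sum B Basis" by (simp add: sum_nonneg)
    fix x v
    have "hessian f x v = hessian f x (\<Sum>b\<in>Basis. (v \<bullet> b) *\<^sub>R b)"
      by (simp add: euclidean_representation)
    also have "\<dots> = (\<Sum>b\<in>Basis. (v \<bullet> b) *\<^sub>R hessian f x b)"
      by (simp add: linear_sum[OF lin] linear_cmul[OF lin])
    also have "norm \<dots> \<le> (\<Sum>b\<in>Basis. \<bar>v \<bullet> b\<bar> * norm (hessian f x b))"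
      by (rule order_trans[OF norm_sum]) simp
    also have "\<dots> \<le> (\<Sum>b\<in>Basis. norm v * B b)"
      by (intro sum_mono mult_mono B Basis_le_norm) auto
    finally show "norm (hessian f x v) \<le> sum B Basis * norm v"
      by (simp add: sum_distrib_left mult.commute)
  qed
qed

text \<open>
  The remainder vanishes at \<open>y = 0\<close> and its derivative is \<open>\<nabla>f (x + y) - \<nabla>f x\<close>, which is bounded by
  \<open>L |y|\<close>. The mean value inequality, used twice, gives \<open>L |y|\<^sup>2\<close>; the usual factor \<open>1/2\<close> is lost.
\<close>

lemma taylor_remainder_bound:
  fixes f :: "'a::euclidean_space \<Rightarrow> real"
  assumes f: "f differentiable_on UNIV" "gradient f differentiable_on UNIV"
    and L: "\<And>x v. norm (hessian f x v) \<le> L * norm v" and "L \<ge> 0"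
  shows "\<bar>f (x + y) - f x - y \<bullet> gradient f x\<bar> \<le> L * (norm y)\<^sup>2"
proof -
  have df: "(f has_derivative (\<lambda>v. v \<bullet> gradient f x)) (at x)" for x
  proof -
    have *: "(f has_derivative frechet_derivative f (at x)) (at x)"
      using f(1) by (simp add: differentiable_on_def frechet_derivative_works)
    have "frechet_derivative f (at x) v = v \<bullet> gradient f x" for v
    proof -
      have lin: "linear (frechet_derivative f (at x))" by (rule has_derivative_linear[OF *])
      have "frechet_derivative f (at x) v = frechet_derivative f (at x) (\<Sum>b\<in>Basis. (v \<bullet> b) *\<^sub>R b)"
        by (simp add: euclidean_representation)
      also have "\<dots> = (\<Sum>b\<in>Basis. (v \<bullet> b) * frechet_derivative f (at x) b)"
        by (simp add: linear_sum[OF lin] linear_cmul[OF lin])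
      finally show ?thesis by (simp add: gradient_def inner_sum_right mult.commute)
    qed
    with * show ?thesis by (metis ext)
  qed
  have dg: "(gradient f has_derivative hessian f x) (at x)" for x
    unfolding hessian_def using f(2) by (simp add: differentiable_on_def frechet_derivative_works)
  have lip: "norm (gradient f (x + z) - gradient f x) \<le> L * norm z" for z
  proof -
    have "onorm (hessian f x) \<le> L" for x
      by (rule onorm_le) (rule L)
    then show ?thesis
      using differentiable_bound[OF convex_UNIV, of "gradient f" "hessian f" L "x + z" x] dg by simp
  qed
  let ?r = "\<lambda>z. f (x + z) - f x - z \<bullet> gradient f x"
  have dr: "(?r has_derivative (\<lambda>v. v \<bullet> (gradient f (x + z) - gradient f x))) (at z within cball 0 (norm y))" for z
  proof -
    have "((\<lambda>z. f (x + z)) has_derivative (\<lambda>v. v \<bullet> gradient f (x + z))) (at z within cball 0 (norm y))"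
      by (rule has_derivative_compose[where f="\<lambda>z. x + z", OF _ df]) (auto intro!: derivative_eq_intros)
    then have "(?r has_derivative (\<lambda>v. v \<bullet> gradient f (x + z) - 0 - v \<bullet> gradient f x)) (at z within cball 0 (norm y))"
      by (intro has_derivative_diff has_derivative_const has_derivative_inner_left has_derivative_ident)
    then show ?thesis by (simp add: inner_diff_right)
  qed
  have "norm (?r y - ?r 0) \<le> (L * norm y) * norm (y - 0)"
  proof (rule differentiable_bound[OF convex_cball dr])
    fix z :: 'a assume z: "z \<in> cball 0 (norm y)"
    show "onorm (\<lambda>v. v \<bullet> (gradient f (x + z) - gradient f x)) \<le> L * norm y"
    proof (rule onorm_le)
      fix v
      have "norm (v \<bullet> (gradient f (x + z) - gradient f x)) \<le> norm v * norm (gradient f (x + z) - gradient f x)"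
        using Cauchy_Schwarz_ineq2 by simp
      also have "\<dots> \<le> norm v * (L * norm y)"
        using z \<open>L \<ge> 0\<close> by (intro mult_left_mono order_trans[OF lip] ) auto
      finally show "norm (v \<bullet> (gradient f (x + z) - gradient f x)) \<le> L * norm y * norm v"
        by (simp add: mult_ac)
    qed
  qed auto
  then show ?thesis by (simp add: power2_eq_square mult.assoc)
qed

text \<open>
  A function that is bounded below and has bounded second derivatives cannot be steep where it is
  close to its lower bound: one step of gradient descent, of length \<open>1 / (2 L)\<close> times the gradient,
  would fall below it. This controls the drift term of a generator by the function itself.
\<close>

lemma gradient_square_le:
  fixes f :: "'a::euclidean_space \<Rightarrow> real"
  assumes f: "f differentiable_on UNIV" "gradient f differentiable_on UNIV"
    and L: "\<And>x v. norm (hessian f x v) \<le> L * norm v" and "L > 0"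
    and c: "\<And>x. c \<le> f x"
  shows "(norm (gradient f x))\<^sup>2 \<le> 4 * L * (f x - c)"
proof -
  let ?g = "gradient f x"
  define y where "y = (- 1 / (2 * L)) *\<^sub>R ?g"
  have "f (x + y) - f x - y \<bullet> ?g \<le> L * (norm y)\<^sup>2"
    using taylor_remainder_bound[OF f L, of x y] \<open>L > 0\<close> by simp
  moreover have "y \<bullet> ?g = - (norm ?g)\<^sup>2 / (2 * L)" by (simp add: y_def power2_norm_eq_inner)
  moreover have "L * (norm y)\<^sup>2 = (norm ?g)\<^sup>2 / (4 * L)"
    using \<open>L > 0\<close> by (simp add: y_def power_mult_distrib power_divide) (simp add: power2_eq_square field_simps)
  ultimately have "(norm ?g)\<^sup>2 / (2 * L) - (norm ?g)\<^sup>2 / (4 * L) \<le> f x - c"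
    using c[of "x + y"] by simp
  then show ?thesis using \<open>L > 0\<close> by (simp add: field_simps)
qed

definition bump :: "'a::euclidean_space \<Rightarrow> real" where
  "bump x = flat_exp 0 (1 - x \<bullet> x)"

text \<open>
  The bump has a nondegenerate maximum at the origin. Hence \<open>R\<^sup>2 (bump 0 - bump (x / R))\<close> is, up to a
  constant, at least \<open>min R\<^sup>2 |x|\<^sup>2\<close>, while its second derivatives are bounded independently of \<open>R\<close>.
\<close>

lemma bump_gap: "exp (- 1) - bump x \<ge> exp (- 1) / 2 * min 1 ((norm x)\<^sup>2)"
proof -
  define s where "s = (norm x)\<^sup>2"
  have s: "s = x \<bullet> x" "s \<ge> 0" by (simp_all add: s_def power2_norm_eq_inner)
  show ?thesis
  proof (cases "s < 1")
    case False
    then show ?thesis using s by (simp add: bump_def flat_exp_def s_def[symmetric])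
  next
    case True
    have "1 + s \<le> exp (s / (1 - s))"
    proof -
      have "s \<le> s / (1 - s)" using True s(2) by (simp add: le_divide_eq mult_left_le)
      then show ?thesis using exp_ge_add_one_self[of "s / (1 - s)"] by linarith
    qed
    then have "exp (- (s / (1 - s))) \<le> 1 / (1 + s)"
      using s(2) by (simp add: exp_minus inverse_eq_divide frac_le)
    also have "\<dots> \<le> 1 - s / 2"
    proof -
      have "s * s \<le> s" using s(2) True by (intro mult_left_le) auto
      then have "1 \<le> (1 - s / 2) * (1 + s)" by (simp add: algebra_simps)
      then show ?thesis using s(2) by (subst pos_divide_le_eq) auto
    qed
    finally have "exp (- 1) * exp (- (s / (1 - s))) \<le> exp (- 1) * (1 - s / 2)"
      by (intro mult_left_mono) auto
    also have "exp (- 1) * exp (- (s / (1 - s))) = exp (- 1 / (1 - s))"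
      using True by (simp add: exp_add[symmetric] field_simps)
    finally show ?thesis
      using True s by (simp add: bump_def flat_exp_def s_def[symmetric] algebra_simps)
  qed
qed

lemma rescaled_bump_test_function:
  assumes "R > 0"
  shows "(\<lambda>x::'a::euclidean_space. c * bump ((1 / R) *\<^sub>R x)) \<in> test_functions"
proof -
  have "(bump :: 'a \<Rightarrow> real) \<in> flat_class"
    unfolding bump_def[abs_def] by (rule flat_class.flat_exp)
  then have "Ck k (\<lambda>x::'a. c * bump ((1 / R) *\<^sub>R x))" for k
    by (intro Ck_rescale Ck_flat_class)
  moreover have "compact (closure {x::'a. c * bump ((1 / R) *\<^sub>R x) \<noteq> 0})"
  proof -
    have "{x. c * bump ((1 / R) *\<^sub>R x) \<noteq> 0} \<subseteq> cball (0::'a) R"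
    proof
      fix x :: 'a assume "x \<in> {x. c * bump ((1 / R) *\<^sub>R x) \<noteq> 0}"
      then have "1 - ((1 / R) *\<^sub>R x) \<bullet> ((1 / R) *\<^sub>R x) > 0"
        by (auto simp: bump_def flat_exp_def split: if_splits)
      then have "(norm ((1 / R) *\<^sub>R x))\<^sup>2 < 1\<^sup>2"
        unfolding power2_norm_eq_inner by simp
      then have "norm ((1 / R) *\<^sub>R x) < 1" by (rule power2_less_imp_less) simp
      then show "x \<in> cball 0 R" using assms by (simp add: field_simps)
    qed
    then have "bounded {x :: 'a. c * bump ((1 / R) *\<^sub>R x) \<noteq> 0}"
      by (rule bounded_subset[OF bounded_cball])
    then show ?thesis by (simp only: compact_closure)
  qed
  ultimately show ?thesis by (simp add: test_functions_def)
qed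

section \<open>Second moments of Levy semigroups\<close>

text \<open>
  The point is that \<open>C\<close> depends on \<open>\<phi>\<close> only through the bound \<open>L\<close> on its Hessian, so that it
  serves all scales of the rescaled bump at once. The diffusion and jump terms are bounded by
  constants, the latter because \<open>\<mu>\<close> has a finite second moment; the drift term is at most
  \<open>|\<kappa>| |\<nabla>\<phi>| \<le> |\<kappa>| (1 + |\<nabla>\<phi>|\<^sup>2)\<close>, and \<open>|\<nabla>\<phi>|\<^sup>2 \<le> 4 L (\<phi> - c)\<close>.
\<close>

lemma levy_khintchine_le:
  fixes \<mu> :: "'a::euclidean_space measure"
  assumes \<alpha>: "sym_nonneg \<alpha>" and \<mu>: "\<mu> \<in> levy_measures2" and "L > 0"
  obtains C where "C \<ge> 0"
    "\<And>\<phi> c x. \<phi> \<in> test_functions \<Longrightarrow> (\<And>x v. norm (hessian \<phi> x v) \<le> L * norm v) \<Longrightarrow>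
      (\<And>x. c \<le> \<phi> x) \<Longrightarrow> levy_khintchine UNIV \<kappa> \<alpha> \<mu> \<phi> x \<le> C * (1 + (\<phi> x - c))"
proof
  define I where "I = (\<integral>x. (norm x)\<^sup>2 \<partial>\<mu>)"
  define S where "S = (\<Sum>b\<in>Basis. norm (\<alpha> b))"
  define C where "C = norm \<kappa> * (1 + 4 * L) + L * S / 2 + L * I"
  have I: "I \<ge> 0" by (simp add: I_def)
  have S: "S \<ge> 0" by (simp add: S_def sum_nonneg)
  show "C \<ge> 0" using I S \<open>L > 0\<close> by (simp add: C_def)
  fix \<phi> :: "'a \<Rightarrow> real" and c x
  assume \<phi>: "\<phi> \<in> test_functions" and hess: "\<And>x v. norm (hessian \<phi> x v) \<le> L * norm v"
    and c: "\<And>x. c \<le> \<phi> x"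
  from \<phi> have "Ck 2 \<phi>" by (simp add: test_functions_def)
  note d = Ck_gradient_differentiable(1,2)[OF this]
  let ?g = "gradient \<phi> x"
  have "\<kappa> \<bullet> ?g \<le> norm \<kappa> * norm ?g" by (rule norm_cauchy_schwarz)
  also have "\<dots> \<le> norm \<kappa> * (1 + 4 * L * (\<phi> x - c))"
  proof (rule mult_left_mono)
    have "2 * norm ?g \<le> 1 + (norm ?g)\<^sup>2"
      using zero_le_power2[of "norm ?g - 1"] by (simp add: power2_eq_square algebra_simps)
    then have "norm ?g \<le> 1 + (norm ?g)\<^sup>2"
      using norm_ge_zero[of ?g] by linarith
    with gradient_square_le[OF d hess \<open>L > 0\<close> c, of x] show "norm ?g \<le> 1 + 4 * L * (\<phi> x - c)"
      by linarith
  qed simp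
  also have "\<dots> \<le> norm \<kappa> * (1 + 4 * L) * (1 + (\<phi> x - c))"
  proof -
    have "1 + 4 * L * (\<phi> x - c) \<le> (1 + 4 * L) * (1 + (\<phi> x - c))"
      using c[of x] \<open>L > 0\<close> by (simp add: algebra_simps)
    then show ?thesis by (simp add: mult.assoc mult_left_mono)
  qed
  finally have drift: "\<kappa> \<bullet> ?g \<le> norm \<kappa> * (1 + 4 * L) * (1 + (\<phi> x - c))" .
  have "trace_op (\<alpha> \<circ> hessian \<phi> x) = (\<Sum>b\<in>Basis. hessian \<phi> x b \<bullet> \<alpha> b)"
    using \<alpha> by (simp add: trace_op_def sym_nonneg_def)
  also have "\<dots> \<le> (\<Sum>b\<in>Basis. L * norm (\<alpha> b))"
  proof (rule sum_mono)
    fix b :: 'a assume "b \<in> Basis"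
    then have "norm (hessian \<phi> x b) \<le> L" using hess[of x b] by simp
    then show "hessian \<phi> x b \<bullet> \<alpha> b \<le> L * norm (\<alpha> b)"
      using norm_cauchy_schwarz[of "hessian \<phi> x b" "\<alpha> b"] by (meson mult_right_mono norm_ge_zero order_trans)
  qed
  also have "\<dots> = L * S" by (simp add: S_def sum_distrib_left)
  finally have diffusion: "trace_op (\<alpha> \<circ> hessian \<phi> x) \<le> L * S" .
  have int: "integrable \<mu> (\<lambda>x. L * (norm x)\<^sup>2)"
  proof -
    have [measurable_cong]: "sets \<mu> = sets borel" and fin: "(\<integral>\<^sup>+x. ennreal ((norm x)\<^sup>2) \<partial>\<mu>) < \<infinity>"
      using \<mu> by (auto simp: levy_measures2_def levy_measures_def)
    have "integrable \<mu> (\<lambda>x. (norm x)\<^sup>2)"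
      by (rule integrableI_nonneg) (use fin in auto)
    then show ?thesis by simp
  qed
  have "(LINT x':UNIV - {0}|\<mu>. \<phi> (x + x') - \<phi> x - indicator UNIV x' * (x' \<bullet> gradient \<phi> x))
      \<le> (\<integral>x'. L * (norm x')\<^sup>2 \<partial>\<mu>)"
    unfolding set_lebesgue_integral_def
  proof (rule integral_mono'[OF int])
    fix x' :: 'a
    have "\<bar>\<phi> (x + x') - \<phi> x - x' \<bullet> gradient \<phi> x\<bar> \<le> L * (norm x')\<^sup>2"
      using taylor_remainder_bound[OF d hess] \<open>L > 0\<close> by simp
    then show "indicator (UNIV - {0}) x' *\<^sub>R (\<phi> (x + x') - \<phi> x - indicator UNIV x' * (x' \<bullet> gradient \<phi> x))
        \<le> L * (norm x')\<^sup>2"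
      by (auto simp: indicator_def)
  qed (use \<open>L > 0\<close> in auto)
  also have "\<dots> = L * I" by (simp add: I_def)
  finally have jumps: "(LINT x':UNIV - {0}|\<mu>. \<phi> (x + x') - \<phi> x - indicator UNIV x' * (x' \<bullet> gradient \<phi> x))
      \<le> L * I" .
  have "L * S / 2 + L * I \<le> (L * S / 2 + L * I) * (1 + (\<phi> x - c))"
  proof -
    have "0 \<le> L * S / 2 + L * I" using I S \<open>L > 0\<close> by simp
    then show ?thesis
      using mult_left_mono[of 1 "1 + (\<phi> x - c)" "L * S / 2 + L * I"] c[of x] by simp
  qed
  with drift diffusion jumps
  have "levy_khintchine UNIV \<kappa> \<alpha> \<mu> \<phi> x
      \<le> norm \<kappa> * (1 + 4 * L) * (1 + (\<phi> x - c)) + (L * S / 2 + L * I) * (1 + (\<phi> x - c))"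
    unfolding levy_khintchine_def by linarith
  also have "\<dots> = C * (1 + (\<phi> x - c))" by (simp add: C_def algebra_simps)
  finally show "levy_khintchine UNIV \<kappa> \<alpha> \<mu> \<phi> x \<le> C * (1 + (\<phi> x - c))" .
qed

lemma kernel_prob:
  assumes "feller_semigroup K" "t \<ge> 0"
  shows "prob_space (K t x)" "sets (K t x) = sets borel"
proof -
  have "K t \<in> borel \<rightarrow>\<^sub>M prob_algebra borel" using assms by (simp add: feller_semigroup_def)
  from measurable_space[OF this, of x] show "prob_space (K t x)" "sets (K t x) = sets borel"
    by (auto simp: space_prob_algebra)
qed

lemma C0_bounded_borel: "\<phi> \<in> C0 \<Longrightarrow> \<phi> \<in> bounded_borel"
proof -
  assume \<phi>: "\<phi> \<in> C0"
  then have cont: "continuous_on UNIV \<phi>" by (simp add: C0_def)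
  from \<phi> obtain S where S: "compact S" "\<And>x. x \<notin> S \<Longrightarrow> \<bar>\<phi> x\<bar> < 1"
    unfolding C0_def using zero_less_one by blast
  have "compact (\<phi> ` S)"
    using cont S(1) by (intro compact_continuous_image) (auto intro: continuous_on_subset)
  then obtain B where B: "\<And>x. x \<in> S \<Longrightarrow> \<bar>\<phi> x\<bar> \<le> B"
    using compact_imp_bounded bounded_iff by (metis imageI real_norm_def)
  have "\<bar>\<phi> x\<bar> \<le> max 1 B" for x
    using S(2)[of x] B[of x] by (cases "x \<in> S") auto
  then have "bounded (range \<phi>)" by (auto simp: bounded_iff intro!: exI[of _ "max 1 B"])
  then show ?thesis
    using borel_measurable_continuous_onI[OF cont] by (simp add: bounded_borel_def)
qed

lemma bounded_borel_integrable:
  assumes K: "feller_semigroup K" "t \<ge> 0" and \<phi>: "\<phi> \<in> bounded_borel"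
  shows "integrable (K t x) \<phi>"
proof -
  interpret prob_space "K t x" by (rule kernel_prob[OF K])
  note [measurable_cong] = kernel_prob(2)[OF K]
  from \<phi> obtain B where "\<And>x. norm (\<phi> x) \<le> B" and "\<phi> \<in> borel_measurable borel"
    by (auto simp: bounded_borel_def bounded_iff)
  then show ?thesis by (intro integrable_const_bound[of _ B]) auto
qed

lemma bounded_borel_affine: "\<phi> \<in> bounded_borel \<Longrightarrow> (\<lambda>x. a * \<phi> x + c) \<in> bounded_borel"
proof -
  assume \<phi>: "\<phi> \<in> bounded_borel"
  then obtain B where "\<And>x. norm (\<phi> x) \<le> B" by (auto simp: bounded_borel_def bounded_iff)
  then have "norm (a * \<phi> x + c) \<le> \<bar>a\<bar> * B + \<bar>c\<bar>" for x
    by (intro order_trans[OF norm_triangle_ineq] add_mono) (auto simp: abs_mult intro!: mult_left_mono)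
  then show ?thesis using \<phi> by (auto simp: bounded_borel_def bounded_iff)
qed

lemma kernel_op_affine:
  assumes K: "feller_semigroup K" "t \<ge> 0" and \<phi>: "\<phi> \<in> bounded_borel"
  shows "kernel_op K t (\<lambda>x. a * \<phi> x + c) = (\<lambda>x. a * kernel_op K t \<phi> x + c)"
proof
  fix x
  interpret prob_space "K t x" by (rule kernel_prob[OF K])
  show "kernel_op K t (\<lambda>x. a * \<phi> x + c) x = a * kernel_op K t \<phi> x + c"
    using bounded_borel_integrable[OF assms, of x] by (simp add: kernel_op_def prob_space)
qed

lemma kernel_op_mono:
  assumes K: "feller_semigroup K" "t \<ge> 0" and "\<phi> \<in> bounded_borel" "\<psi> \<in> bounded_borel"
    and "\<And>x. \<phi> x \<le> \<psi> x"
  shows "kernel_op K t \<phi> x \<le> kernel_op K t \<psi> x"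
  unfolding kernel_op_def using assms by (intro integral_mono bounded_borel_integrable)

text \<open>
  For small \<open>h\<close> the definition of the generator gives \<open>T\<^sub>h w \<le> w + h (\<psi> + 1) \<le> (1 + h (C + 1)) w\<close>
  uniformly in space, where \<open>w = \<phi> + c\<close>; the error \<open>1\<close> is absorbed since \<open>w \<ge> 1\<close>. Taking
  \<open>h = 1/n\<close> and iterating \<open>n\<close> times with the positivity of the semigroup replaces Gronwall's lemma.
\<close>

lemma kernel_op_lyapunov:
  assumes K: "feller_semigroup K" and gen: "(\<phi>, \<psi>) \<in> generator_of K"
    and pos: "\<And>x. 1 \<le> \<phi> x + c" and le: "\<And>x. \<psi> x \<le> C * (\<phi> x + c)" and "C \<ge> 0"
  shows "kernel_op K 1 (\<lambda>x. \<phi> x + c) x \<le> exp (C + 1) * (\<phi> x + c)"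
proof -
  let ?w = "\<lambda>x. \<phi> x + c"
  have \<phi>: "\<phi> \<in> C0" and lim: "uniform_limit UNIV (\<lambda>t x. (kernel_op K t \<phi> x - \<phi> x) / t) \<psi> (at_right 0)"
    using gen by (auto simp: generator_of_def)
  have wb: "?w \<in> bounded_borel"
    using bounded_borel_affine[OF C0_bounded_borel[OF \<phi>], of 1 c] by simp
  from uniform_limitD[OF lim, of 1]
  obtain \<delta> where \<delta>: "\<delta> > 0"
    "\<And>h x. 0 < h \<Longrightarrow> h < \<delta> \<Longrightarrow> \<bar>(kernel_op K h \<phi> x - \<phi> x) / h - \<psi> x\<bar> < 1"
    by (auto simp: eventually_at_right_field dist_real_def)
  obtain n where n: "1 / real (Suc n) < \<delta>"
    using reals_Archimedean[OF \<delta>(1)] by (auto simp: inverse_eq_divide)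
  define h where "h = 1 / real (Suc n)"
  have h: "0 < h" "h < \<delta>" using n by (auto simp: h_def)
  define q where "q = 1 + h * (C + 1)"
  have "q \<ge> 0" using h \<open>C \<ge> 0\<close> by (simp add: q_def)
  have opw: "kernel_op K h ?w = (\<lambda>x. kernel_op K h \<phi> x + c)"
    using kernel_op_affine[OF K _ C0_bounded_borel[OF \<phi>], of h 1 c] h by simp
  have opwb: "kernel_op K h ?w \<in> bounded_borel"
  proof -
    have "kernel_op K h \<phi> \<in> C0" using K \<phi> h by (simp add: feller_semigroup_def)
    then show ?thesis
      unfolding opw using bounded_borel_affine[OF C0_bounded_borel, of _ 1 c] by simp
  qed
  have step: "kernel_op K h ?w x \<le> q * ?w x" for x
  proof -
    have "(kernel_op K h \<phi> x - \<phi> x) / h < \<psi> x + 1"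
      using \<delta>(2)[OF h, of x] by linarith
    also have "\<dots> \<le> (C + 1) * ?w x"
      using le[of x] pos[of x] by (simp add: algebra_simps)
    finally have "kernel_op K h \<phi> x - \<phi> x < (C + 1) * ?w x * h"
      using h(1) by (simp add: divide_less_eq)
    then show ?thesis unfolding opw q_def by (simp add: algebra_simps)
  qed
  have "kernel_op K (real k * h) ?w x \<le> q ^ k * ?w x" for k
  proof (induction k)
    case 0
    have "kernel_op K 0 ?w = ?w" using K wb by (simp add: feller_semigroup_def)
    then show ?case by simp
  next
    case (Suc k)
    have kh: "0 \<le> real k * h" using h by simp
    have "kernel_op K (real k * h + h) ?w = kernel_op K (real k * h) (kernel_op K h ?w)"
      using K wb kh h unfolding feller_semigroup_def by (meson less_imp_le)
    then have "kernel_op K (real (Suc k) * h) ?w x = kernel_op K (real k * h) (kernel_op K h ?w) x"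
      by (simp add: algebra_simps)
    also have "\<dots> \<le> kernel_op K (real k * h) (\<lambda>x. q * ?w x + 0) x"
      by (rule kernel_op_mono[OF K kh opwb bounded_borel_affine[OF wb]]) (use step in simp)
    also have "\<dots> = q * kernel_op K (real k * h) ?w x"
      unfolding kernel_op_affine[OF K kh wb] by simp
    also have "\<dots> \<le> q * (q ^ k * ?w x)"
      by (rule mult_left_mono[OF Suc.IH \<open>q \<ge> 0\<close>])
    finally show ?case by (simp add: mult.assoc)
  qed
  from this[of "Suc n"] have "kernel_op K 1 ?w x \<le> q ^ Suc n * ?w x"
    by (simp add: h_def)
  also have "q ^ Suc n \<le> exp (C + 1)"
  proof -
    have "q ^ Suc n \<le> exp (h * (C + 1)) ^ Suc n"
      using \<open>q \<ge> 0\<close> exp_ge_add_one_self[of "h * (C + 1)"] by (intro power_mono) (auto simp: q_def)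
    also have "\<dots> = exp (real (Suc n) * (h * (C + 1)))" by (rule exp_of_nat_mult[symmetric])
    also have "real (Suc n) * (h * (C + 1)) = C + 1" by (simp add: h_def)
    finally show ?thesis .
  qed
  finally show ?thesis using pos[of x] by (simp add: mult_right_mono)
qed

lemma kernel_of_feller_generator:
  assumes "A \<in> feller_generators"
  shows "feller_semigroup (kernel A)" "generator_of (kernel A) = A"
proof -
  have "\<exists>K. feller_semigroup K \<and> generator_of K = A"
    using assms by (auto simp: feller_generators_def)
  from someI_ex[OF this] show "feller_semigroup (kernel A)" "generator_of (kernel A) = A"
    by (auto simp: kernel_def)
qed

text \<open>
  The hypothesis on the generator concerns smooth functions of compact support only. The truncated
  quadratic functions made from the rescaled bump satisfy the Lyapunov condition with a constant
  that is independent of the scale, hence \<open>E (min R\<^sup>2 |X\<^sub>1|\<^sup>2)\<close> is bounded uniformly in \<open>R\<close>.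
\<close>

lemma levy_generators2_second_moment:
  fixes A :: "'a::euclidean_space operator"
  assumes "A \<in> levy_generators2"
  shows "(\<integral>\<^sup>+x. ennreal ((norm x)\<^sup>2) \<partial>kernel A 1 0) < \<infinity>"
proof -
  from assms obtain \<kappa> \<alpha> \<mu> where A: "A \<in> feller_generators" and \<alpha>: "sym_nonneg \<alpha>"
    and \<mu>: "\<mu> \<in> levy_measures2"
    and gen: "\<And>\<phi>. \<phi> \<in> test_functions \<Longrightarrow> (\<phi>, levy_khintchine UNIV \<kappa> \<alpha> \<mu> \<phi>) \<in> A"
    by (auto simp: levy_generators2_def)
  note K = kernel_of_feller_generator[OF A]
  have bump_test: "(bump :: 'a \<Rightarrow> real) \<in> test_functions"
    using rescaled_bump_test_function[of 1 1] by simp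
  obtain L0 where L0: "L0 \<ge> 0" "\<And>(x::'a) v. norm (hessian bump x v) \<le> L0 * norm v"
    using hessian_bounded[OF bump_test] by blast
  define L where "L = L0 + 1"
  have L: "L > 0" "norm (hessian bump x v) \<le> L * norm v" for x v :: 'a
    using L0(1) order_trans[OF L0(2)[of x v], of "L * norm v"] by (auto simp: L_def algebra_simps)
  obtain C where C: "C \<ge> 0"
    "\<And>\<phi> c x. \<phi> \<in> test_functions \<Longrightarrow> (\<And>x v. norm (hessian \<phi> x v) \<le> L * norm v) \<Longrightarrow>
      (\<And>x. c \<le> \<phi> x) \<Longrightarrow> levy_khintchine UNIV \<kappa> \<alpha> \<mu> \<phi> x \<le> C * (1 + (\<phi> x - c))"
    by (rule levy_khintchine_le[OF \<alpha> \<mu> L(1), of \<kappa>]) blast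
  define B where "B = 2 * exp 1 * exp (C + 1)"
  have d: "(bump :: 'a \<Rightarrow> real) differentiable_on UNIV" "gradient (bump :: 'a \<Rightarrow> real) differentiable_on UNIV"
    using Ck_gradient_differentiable[of "bump :: 'a \<Rightarrow> real"] bump_test by (auto simp: test_functions_def)
  note Kp = kernel_prob[OF K(1), of 1 0, simplified]
  interpret prob_space "kernel A 1 0" by (rule Kp)
  note [measurable_cong] = Kp(2)
  have bound: "(\<integral>\<^sup>+x. ennreal (min (R\<^sup>2) ((norm x)\<^sup>2)) \<partial>kernel A 1 0) \<le> ennreal B" if "R > 0" for R
  proof -
    define \<phi> where "\<phi> = (\<lambda>x::'a. (- R\<^sup>2) * bump ((1 / R) *\<^sub>R x))"
    define w where "w = (\<lambda>x. \<phi> x + (R\<^sup>2 * exp (- 1) + 1))"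
    have \<phi>: "\<phi> \<in> test_functions"
      unfolding \<phi>_def by (rule rescaled_bump_test_function[OF that])
    have hess: "norm (hessian \<phi> x v) \<le> L * norm v" for x v
      unfolding \<phi>_def hessian_rescale[OF d] using that L(2)[of "(1 / R) *\<^sub>R x" v]
      by (simp add: power2_eq_square)
    have gap: "exp (- 1) / 2 * min (R\<^sup>2) ((norm x)\<^sup>2) \<le> \<phi> x + R\<^sup>2 * exp (- 1)" for x
    proof -
      have "R\<^sup>2 * (exp (- 1) / 2 * min 1 ((norm ((1 / R) *\<^sub>R x))\<^sup>2)) \<le> R\<^sup>2 * (exp (- 1) - bump ((1 / R) *\<^sub>R x))"
        by (intro mult_left_mono bump_gap) auto
      moreover have "R\<^sup>2 * min 1 ((norm ((1 / R) *\<^sub>R x))\<^sup>2) = min (R\<^sup>2) ((norm x)\<^sup>2)"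
        using that by (simp add: min_mult_distrib_left power_divide)
      ultimately show ?thesis by (simp add: \<phi>_def algebra_simps)
    qed
    have low: "- (R\<^sup>2 * exp (- 1)) \<le> \<phi> x" for x
    proof -
      have "0 \<le> exp (- 1) / 2 * min (R\<^sup>2) ((norm x)\<^sup>2)" by simp
      then show ?thesis using gap[of x] by linarith
    qed
    have "kernel_op (kernel A) 1 w 0 \<le> exp (C + 1) * (\<phi> 0 + (R\<^sup>2 * exp (- 1) + 1))"
      unfolding w_def
    proof (rule kernel_op_lyapunov[OF K(1) _ _ _ C(1)])
      show "(\<phi>, levy_khintchine UNIV \<kappa> \<alpha> \<mu> \<phi>) \<in> generator_of (kernel A)"
        using gen[OF \<phi>] K(2) by simp
      show "1 \<le> \<phi> x + (R\<^sup>2 * exp (- 1) + 1)" for x using low[of x] by simp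
      show "levy_khintchine UNIV \<kappa> \<alpha> \<mu> \<phi> x \<le> C * (\<phi> x + (R\<^sup>2 * exp (- 1) + 1))" for x
        using C(2)[OF \<phi> hess low, of x] by (simp add: algebra_simps)
    qed
    also have "\<phi> 0 + (R\<^sup>2 * exp (- 1) + 1) = 1" by (simp add: \<phi>_def bump_def flat_exp_def)
    finally have Ew: "expectation w \<le> exp (C + 1)" by (simp add: kernel_op_def)
    have "(\<phi>, levy_khintchine UNIV \<kappa> \<alpha> \<mu> \<phi>) \<in> generator_of (kernel A)"
      using gen[OF \<phi>] K(2) by simp
    then have "\<phi> \<in> C0" by (simp add: generator_of_def)
    then have intw: "integrable (kernel A 1 0) w"
      unfolding w_def using bounded_borel_affine[OF C0_bounded_borel, of \<phi> 1]
      by (intro bounded_borel_integrable[OF K(1)]) auto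
    have w0: "0 \<le> w x" for x using low[of x] by (simp add: w_def)
    have "min (R\<^sup>2) ((norm x)\<^sup>2) \<le> 2 * exp 1 * w x" for x
    proof -
      have "2 * exp 1 * (exp (- 1) / 2 * min (R\<^sup>2) ((norm x)\<^sup>2)) \<le> 2 * exp 1 * w x"
        using gap[of x] by (intro mult_left_mono) (auto simp: w_def)
      also have "2 * exp 1 * (exp (- 1) / 2 * min (R\<^sup>2) ((norm x)\<^sup>2)) = min (R\<^sup>2) ((norm x)\<^sup>2)"
        by (simp add: exp_minus)
      finally show ?thesis .
    qed
    then have "(\<integral>\<^sup>+x. ennreal (min (R\<^sup>2) ((norm x)\<^sup>2)) \<partial>kernel A 1 0)
        \<le> (\<integral>\<^sup>+x. ennreal (2 * exp 1 * w x) \<partial>kernel A 1 0)"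
      by (intro nn_integral_mono ennreal_leI)
    also have "\<dots> = ennreal (expectation (\<lambda>x. 2 * exp 1 * w x))"
      using intw w0 by (intro nn_integral_eq_integral) auto
    also have "\<dots> \<le> ennreal B"
      using Ew by (intro ennreal_leI) (simp add: B_def)
    finally show ?thesis .
  qed
  have "(\<integral>\<^sup>+x. ennreal ((norm x)\<^sup>2) \<partial>kernel A 1 0)
      \<le> (\<integral>\<^sup>+x. (SUP n. ennreal (min ((real (Suc n))\<^sup>2) ((norm x)\<^sup>2))) \<partial>kernel A 1 0)"
  proof (rule nn_integral_mono)
    fix x :: 'a
    obtain n where "norm x \<le> real n" using real_arch_simple by blast
    then have "(norm x)\<^sup>2 \<le> (real (Suc n))\<^sup>2" by (intro power_mono) auto
    then show "ennreal ((norm x)\<^sup>2) \<le> (SUP n. ennreal (min ((real (Suc n))\<^sup>2) ((norm x)\<^sup>2)))"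
      by (intro SUP_upper2[of n]) (auto simp: min_absorb2)
  qed
  also have "\<dots> = (SUP n. \<integral>\<^sup>+x. ennreal (min ((real (Suc n))\<^sup>2) ((norm x)\<^sup>2)) \<partial>kernel A 1 0)"
  proof (rule nn_integral_monotone_convergence_SUP)
    show "incseq (\<lambda>n x. ennreal (min ((real (Suc n))\<^sup>2) ((norm x)\<^sup>2)))"
      by (intro incseq_SucI le_funI ennreal_leI min.mono power_mono) auto
  qed auto
  also have "\<dots> \<le> ennreal B"
    by (intro SUP_least bound) auto
  finally show ?thesis using ennreal_less_top le_less_trans infinity_ennreal_def by metis
qed

section \<open>Marginals of couplings\<close>

text \<open>
  Strong continuity at time \<open>0\<close> passes to all times because the operators are contractions:
  \<open>|T\<^sub>t \<phi> - T\<^sub>s \<phi>|\<close> is at most the supremum of \<open>|T\<^sub>h \<phi> - \<phi>|\<close>, with \<open>h = |t - s|\<close>.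
\<close>

lemma C0_subset_continuity_domain:
  assumes A: "A \<in> feller_generators"
  shows "C0 \<subseteq> continuity_domain A"
proof
  fix \<phi> :: "'a \<Rightarrow> real" assume \<phi>: "\<phi> \<in> C0"
  note K = kernel_of_feller_generator(1)[OF A]
  let ?T = "kernel_op (kernel A)"
  have b: "\<phi> \<in> bounded_borel" by (rule C0_bounded_borel[OF \<phi>])
  have T_C0: "?T t \<phi> \<in> C0" if "t \<ge> 0" for t
    using K \<phi> that by (simp add: feller_semigroup_def)
  have semi: "?T (t + s) \<phi> = ?T t (?T s \<phi>)" if "t \<ge> 0" "s \<ge> 0" for t s
    using K b that unfolding feller_semigroup_def by blast
  have contraction: "\<bar>?T t (?T s \<phi>) x - ?T t \<phi> x\<bar> \<le> e"
    if "t \<ge> 0" "s \<ge> 0" and e: "\<And>y. \<bar>?T s \<phi> y - \<phi> y\<bar> \<le> e" for t s e x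
  proof -
    interpret prob_space "kernel A t x" by (rule kernel_prob[OF K that(1)])
    have i: "integrable (kernel A t x) (?T s \<phi>)" "integrable (kernel A t x) \<phi>"
      by (intro bounded_borel_integrable[OF K that(1)] C0_bounded_borel T_C0 that \<phi>)+
    have "\<bar>?T t (?T s \<phi>) x - ?T t \<phi> x\<bar> = \<bar>expectation (\<lambda>y. ?T s \<phi> y - \<phi> y)\<bar>"
      using i unfolding kernel_op_def[of _ t] by simp
    also have "\<dots> \<le> expectation (\<lambda>y. \<bar>?T s \<phi> y - \<phi> y\<bar>)" by (rule integral_abs_bound)
    also have "\<dots> \<le> expectation (\<lambda>y. e)"
      using i e by (intro integral_mono) auto
    finally show ?thesis by (simp add: prob_space)
  qed
  have "uniform_limit UNIV (\<lambda>t. ?T t \<phi>) (?T s \<phi>) (at s within {0..})" if s: "s \<ge> 0" for s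
  proof (rule uniform_limitI)
    fix e :: real assume "e > 0"
    have "uniform_limit UNIV (\<lambda>t. ?T t \<phi>) \<phi> (at_right 0)"
      using K \<phi> by (simp add: feller_semigroup_def)
    from uniform_limitD[OF this, of "e / 2"] \<open>e > 0\<close>
    obtain d where d: "d > 0" "\<And>h x. 0 < h \<Longrightarrow> h < d \<Longrightarrow> \<bar>?T h \<phi> x - \<phi> x\<bar> < e / 2"
      by (auto simp: eventually_at_right_field dist_real_def)
    have "dist (?T t \<phi> x) (?T s \<phi> x) < e" if t: "t \<in> {0..}" "t \<noteq> s" "dist t s < d" for t x
    proof -
      define h where "h = \<bar>t - s\<bar>"
      have h: "0 < h" "h < d" using t by (auto simp: h_def dist_real_def)
      have "min t s \<ge> 0" using s t by simp
      then have "\<bar>?T (min t s) (?T h \<phi>) x - ?T (min t s) \<phi> x\<bar> \<le> e / 2"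
        using h d(2)[OF h] by (intro contraction) (auto simp: less_imp_le)
      moreover have "?T (min t s) (?T h \<phi>) = ?T (max t s) \<phi>"
      proof -
        have "min t s + h = max t s" by (auto simp: h_def)
        then show ?thesis using semi[OF \<open>min t s \<ge> 0\<close>, of h] h by simp
      qed
      ultimately have "\<bar>?T (max t s) \<phi> x - ?T (min t s) \<phi> x\<bar> < e" using \<open>e > 0\<close> by simp
      then show ?thesis
        by (auto simp: dist_real_def max_def min_def abs_minus_commute split: if_splits)
    qed
    then show "\<forall>\<^sub>F t in at s within {0..}. \<forall>x\<in>UNIV. dist (?T t \<phi> x) (?T s \<phi> x) < e"
      using d(1) by (auto simp: eventually_at)
  qed
  then show "\<phi> \<in> continuity_domain A"
    using \<phi> T_C0 bounded_borel_integrable[OF K _ b]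
    by (auto simp: continuity_domain_def exp_op_def locally_uniform_limit_def C0_def
        intro!: exI[of _ UNIV])
qed

text \<open>
  Indicators of compact sets are decreasing limits of tent functions in \<open>C0\<close>, and closed sets are
  increasing unions of compact ones.
\<close>

lemma prob_measure_eqI_C0:
  fixes P Q :: "'a::euclidean_space measure"
  assumes P: "prob_space P" "sets P = sets borel" and Q: "prob_space Q" "sets Q = sets borel"
    and eq: "\<And>\<phi>. \<phi> \<in> C0 \<Longrightarrow> (\<integral>x. \<phi> x \<partial>P) = (\<integral>x. \<phi> x \<partial>Q)"
  shows "P = Q"
proof -
  interpret P: prob_space P by (rule P)
  interpret Q: prob_space Q by (rule Q)
  have lim: "(\<lambda>n. \<integral>x. max 0 (1 - real (Suc n) * infdist x S) \<partial>R) \<longlonglongrightarrow> measure R S"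
    if R: "prob_space R" "sets R = sets borel" and S: "compact S" "S \<noteq> {}" for R and S :: "'a set"
  proof -
    interpret R: prob_space R by (rule R)
    note [measurable_cong] = R(2)
    have cl: "closed S" using S by (simp add: compact_imp_closed)
    then have Sm: "S \<in> sets R" using R(2) by simp
    have "(\<lambda>n. \<integral>x. max 0 (1 - real (Suc n) * infdist x S) \<partial>R) \<longlonglongrightarrow> (\<integral>x. indicator S x \<partial>R)"
    proof (rule integral_dominated_convergence[where w="\<lambda>_. 1"])
      show "AE x in R. (\<lambda>n. max 0 (1 - real (Suc n) * infdist x S)) \<longlonglongrightarrow> indicator S x"
      proof (rule AE_I2)
        fix x
        show "(\<lambda>n. max 0 (1 - real (Suc n) * infdist x S)) \<longlonglongrightarrow> indicator S x"
        proof (cases "x \<in> S")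
          case False
          then have pos: "infdist x S > 0"
            using cl S(2) in_closed_iff_infdist_zero[of S x] infdist_nonneg[of x S] by linarith
          have "eventually (\<lambda>n. 1 / infdist x S < real (Suc n)) sequentially"
          proof -
            obtain n0 where "1 / infdist x S < real n0" using reals_Archimedean2 by blast
            then show ?thesis
              by (intro eventually_sequentiallyI[of n0]) linarith
          qed
          then have "eventually (\<lambda>n. max 0 (1 - real (Suc n) * infdist x S) = 0) sequentially"
            by eventually_elim (use pos in \<open>simp add: divide_less_eq\<close>)
          then show ?thesis using False by (simp add: tendsto_eventually)
        qed simp
      qed
      show "AE x in R. norm (max 0 (1 - real (Suc n) * infdist x S)) \<le> 1" for n
        by (auto simp: infdist_nonneg)
    qed (use Sm in \<open>auto intro!: borel_measurable_max borel_measurable_diff borel_measurable_times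
        borel_measurable_continuous_onI simp: R(2) measurable_cong_sets[OF R(2) refl] continuous_intros\<close>)
    then show ?thesis using Sm by simp
  qed
  have C0: "(\<lambda>x. max 0 (1 - real (Suc n) * infdist x S)) \<in> C0" if S: "compact S" "S \<noteq> {}" for n and S :: "'a set"
  proof -
    have "\<bar>max 0 (1 - real (Suc n) * infdist x S)\<bar> < e" if "x \<notin> {x. infdist x S \<le> 1}" "e > 0" for e x
    proof -
      have "1 \<le> real (Suc n) * infdist x S" using that mult_mono[of 1 "real (Suc n)" 1 "infdist x S"] by simp
      then show ?thesis using \<open>e > 0\<close> by simp
    qed
    moreover have "compact {x. infdist x S \<le> 1}" by (rule compact_infdist_le[OF S(2,1)]) simp
    moreover have "continuous_on UNIV (\<lambda>x. max 0 (1 - real (Suc n) * infdist x S))"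
      by (intro continuous_intros)
    ultimately show ?thesis unfolding C0_def by blast
  qed
  have compact: "measure P S = measure Q S" if "compact S" for S
  proof (cases "S = {}")
    case False
    have "measure P S = lim (\<lambda>n. \<integral>x. max 0 (1 - real (Suc n) * infdist x S) \<partial>P)"
      using lim[OF P that False] by (rule limI[symmetric])
    also have "\<dots> = lim (\<lambda>n. \<integral>x. max 0 (1 - real (Suc n) * infdist x S) \<partial>Q)"
      using eq[OF C0[OF that False]] by simp
    also have "\<dots> = measure Q S" using lim[OF Q that False] by (rule limI)
    finally show ?thesis .
  qed simp
  have closed: "measure P S = measure Q S" if S: "closed S" for S
  proof -
    have U: "S = (\<Union>n. S \<inter> cball 0 (real n))"
      by (auto intro: real_arch_simple)
    have inc: "incseq (\<lambda>n. S \<inter> cball 0 (real n))" by (auto simp: incseq_def)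
    have "S \<inter> cball 0 (real n) \<in> sets borel" for n
      by (intro borel_closed closed_Int S closed_cball)
    then have meas: "range (\<lambda>n. S \<inter> cball 0 (real n)) \<subseteq> sets P" "range (\<lambda>n. S \<inter> cball 0 (real n)) \<subseteq> sets Q"
      unfolding P(2) Q(2) by blast+
    have "(\<lambda>n. measure P (S \<inter> cball 0 (real n))) \<longlonglongrightarrow> measure P S"
      using P.finite_Lim_measure_incseq[OF meas(1) inc] unfolding U[symmetric] .
    moreover have "(\<lambda>n. measure Q (S \<inter> cball 0 (real n))) \<longlonglongrightarrow> measure Q S"
      using Q.finite_Lim_measure_incseq[OF meas(2) inc] unfolding U[symmetric] .
    moreover have "measure P (S \<inter> cball 0 (real n)) = measure Q (S \<inter> cball 0 (real n))" for n
      by (intro compact closed_Int_compact S compact_cball)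
    ultimately show ?thesis using LIMSEQ_unique by simp
  qed
  show ?thesis
  proof (rule measure_eqI_generator_eq[where E="Collect closed" and \<Omega>=UNIV and A="\<lambda>_. UNIV"])
    show "Int_stable (Collect closed :: 'a set set)" by (auto simp: Int_stable_def)
    show "sets P = sigma_sets UNIV (Collect closed)" "sets Q = sigma_sets UNIV (Collect closed)"
      unfolding P(2) Q(2) borel_eq_closed by simp_all
  qed (auto simp: P.emeasure_eq_measure Q.emeasure_eq_measure closed)
qed

text \<open>
  The continuity domains contain \<open>C0\<close>, so the defining identities of a coupling can be tested on
  enough functions to determine the marginal laws.
\<close>

lemma coupling_marginals:
  fixes A B :: "'a::euclidean_space operator"
  assumes A: "A \<in> feller_generators" and B: "B \<in> feller_generators" and J: "J \<in> couplings A B" and "t \<ge> 0"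
  shows "distr (kernel J t (x, y)) borel fst = kernel A t x"
    and "distr (kernel J t (x, y)) borel snd = kernel B t y"
proof -
  have "J \<in> feller_generators" using J by (simp add: couplings_def)
  note KJ = kernel_prob[OF kernel_of_feller_generator(1)[OF this] \<open>t \<ge> 0\<close>, of "(x, y)"]
  note KA = kernel_prob[OF kernel_of_feller_generator(1)[OF A] \<open>t \<ge> 0\<close>, of x]
  note KB = kernel_prob[OF kernel_of_feller_generator(1)[OF B] \<open>t \<ge> 0\<close>, of y]
  interpret prob_space "kernel J t (x, y)" by (rule KJ)
  have fst: "fst \<in> kernel J t (x, y) \<rightarrow>\<^sub>M borel" and snd: "snd \<in> kernel J t (x, y) \<rightarrow>\<^sub>M borel"
    unfolding measurable_cong_sets[OF KJ(2) refl]
    by (intro borel_measurable_continuous_onI continuous_intros)+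
  show "distr (kernel J t (x, y)) borel fst = kernel A t x"
  proof (rule prob_measure_eqI_C0[OF prob_space_distr[OF fst] _ KA])
    fix \<phi> :: "'a \<Rightarrow> real" assume \<phi>: "\<phi> \<in> C0"
    then have "\<phi> \<in> continuity_domain A" using C0_subset_continuity_domain[OF A] by auto
    then have "exp_op J t (\<lambda>(x, y). \<phi> x) (x, y) = exp_op A t \<phi> x"
      using J \<open>t \<ge> 0\<close> by (simp add: couplings_def)
    moreover have "\<phi> \<in> borel_measurable borel"
      using C0_bounded_borel[OF \<phi>] by (simp add: bounded_borel_def)
    ultimately show "(\<integral>x. \<phi> x \<partial>distr (kernel J t (x, y)) borel fst) = (\<integral>x. \<phi> x \<partial>kernel A t x)"
      by (simp add: integral_distr[OF fst] exp_op_def kernel_op_def case_prod_beta)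
  qed simp
  show "distr (kernel J t (x, y)) borel snd = kernel B t y"
  proof (rule prob_measure_eqI_C0[OF prob_space_distr[OF snd] _ KB])
    fix \<phi> :: "'a \<Rightarrow> real" assume \<phi>: "\<phi> \<in> C0"
    then have "\<phi> \<in> continuity_domain B" using C0_subset_continuity_domain[OF B] by auto
    then have "exp_op J t (\<lambda>(x, y). \<phi> y) (x, y) = exp_op B t \<phi> y"
      using J \<open>t \<ge> 0\<close> by (simp add: couplings_def)
    moreover have "\<phi> \<in> borel_measurable borel"
      using C0_bounded_borel[OF \<phi>] by (simp add: bounded_borel_def)
    ultimately show "(\<integral>x. \<phi> x \<partial>distr (kernel J t (x, y)) borel snd) = (\<integral>x. \<phi> x \<partial>kernel B t y)"
      by (simp add: integral_distr[OF snd] exp_op_def kernel_op_def case_prod_beta)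
  qed simp
qed

text \<open>
  The second moment bound is essential here: without integrability the mean vector would be the
  default value of the integral, unrelated to the difference of the two processes.
\<close>

lemma mean_vector_marginal:
  fixes A :: "'a::euclidean_space operator" and U :: "'w \<Rightarrow> 'a"
  assumes A: "A \<in> levy_generators2" and M: "prob_space M" and U: "U \<in> borel_measurable M"
    and law: "kernel A 1 0 = distr M borel U"
  shows "integrable M U" "mean_vector A = (\<integral>\<omega>. U \<omega> \<partial>M)"
proof -
  interpret prob_space M by (rule M)
  note [measurable] = U
  have "(\<integral>\<^sup>+\<omega>. ennreal ((norm (U \<omega>))\<^sup>2) \<partial>M) < \<infinity>"
    using levy_generators2_second_moment[OF A] unfolding law by (subst (asm) nn_integral_distr) auto
  then have "integrable M (\<lambda>\<omega>. (norm (U \<omega>))\<^sup>2)"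
    by (intro integrableI_nonneg) auto
  then show "integrable M U" by (rule square_norm_integrable_imp_integrable[OF U])
  show "mean_vector A = (\<integral>\<omega>. U \<omega> \<partial>M)"
    unfolding mean_vector_def law by (rule integral_distr) auto
qed

lemma locally_uniform_limit_tendsto:
  assumes "locally_uniform_limit f g F"
  shows "((\<lambda>h. f h x) \<longlongrightarrow> g x) F"
  using assms tendsto_uniform_limitI unfolding locally_uniform_limit_def by metis

lemma extended_domain_right_derivative:
  assumes "\<phi> \<in> extended_domain A"
  shows "((\<lambda>h. (exp_op A h \<phi> x - exp_op A 0 \<phi> x) / h) \<longlongrightarrow> extended_generator A \<phi> x) (at_right 0)"
proof -
  from assms obtain g where g: "is_right_derivative A \<phi> 0 g"
    by (auto simp: extended_domain_def)
  have lim: "((\<lambda>h. (exp_op A h \<phi> x - exp_op A 0 \<phi> x) / h) \<longlongrightarrow> g' x) (at_right 0)"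
    if "is_right_derivative A \<phi> 0 g'" for g' x
    using that locally_uniform_limit_tendsto[of _ g' "at_right 0" x]
    unfolding is_right_derivative_def by force
  have "extended_generator A \<phi> = g"
    unfolding extended_generator_def
  proof (rule the_equality)
    fix g' assume g': "is_right_derivative A \<phi> 0 g'"
    show "g' = g"
      by (rule ext, rule tendsto_unique[OF _ lim[OF g'] lim[OF g]]) simp
  qed (rule g)
  then show ?thesis using lim[OF g] by simp
qed

section \<open>Maximal inequality for optimal Levy couplings\<close>

theorem theorem2p35:
  fixes A B :: "'a::euclidean_space operator"
    and J :: "('a \<times> 'a) operator"
    and M :: "'w measure"
    and X Y :: "real \<Rightarrow> 'w \<Rightarrow> 'a"
  assumes "A \<in> levy_generators2" and "B \<in> levy_generators2"
    and "optimal_levy_coupling A B J"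
    and "levy_process_with_generator M (\<lambda>t \<omega>. (X t \<omega>, Y t \<omega>)) J"
  shows "(\<forall>T\<ge>0. (\<integral>\<^sup>+\<omega>. (SUP t\<in>{0..T}. ennreal ((norm (X t \<omega> - Y t \<omega>))\<^sup>2)) \<partial>M)
             \<le> ennreal (8 * max T (T\<^sup>2) * (wasserstein_generator_metric A B)\<^sup>2)) \<and>
         (mean_vector A = 0 \<and> mean_vector B = 0 \<longrightarrow>
           (\<forall>T\<ge>0. (\<integral>\<^sup>+\<omega>. (SUP t\<in>{0..T}. ennreal ((norm (X t \<omega> - Y t \<omega>))\<^sup>2)) \<partial>M)
             \<le> ennreal (4 * T * (wasserstein_generator_metric A B)\<^sup>2)))"
proof -
  define Z where "Z t \<omega> = (X t \<omega>, Y t \<omega>)" for t \<omega>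
  define D where "D t \<omega> = X t \<omega> - Y t \<omega>" for t \<omega>
  have Z: "levy_process M Z" and law: "\<And>t z. t \<ge> 0 \<Longrightarrow> kernel J t z = distr M borel (\<lambda>\<omega>. z + Z t \<omega>)"
    using assms(4) by (auto simp: levy_process_with_generator_def Z_def[abs_def])
  interpret prob_space M by (rule levy_processD[OF Z])
  have X: "levy_process M X" and Y: "levy_process M Y"
    using levy_process_linear_image[OF Z bounded_linear_fst] levy_process_linear_image[OF Z bounded_linear_snd]
    by (simp_all add: Z_def)
  have D: "levy_process M D"
    using levy_process_linear_image[OF Z bounded_linear_sub[OF bounded_linear_fst bounded_linear_snd]]
    by (simp add: Z_def D_def[abs_def])
  have J: "J \<in> couplings A B" "c2 \<in> extended_domain J"
    "ereal (extended_generator J c2 (0, 0)) = theta2 0 0 A B"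
    using assms(3) by (auto simp: optimal_levy_coupling_def optimal_markov_coupling_def)
  have AB: "A \<in> feller_generators" "B \<in> feller_generators"
    using assms by (auto simp: levy_generators2_def)

  have law0: "kernel J t (0, 0) = distr M borel (Z t)" if "t \<ge> 0" for t
    using law[OF that, of 0] unfolding add_0 by (simp add: zero_prod_def)
  have c2m: "(c2 :: 'a \<times> 'a \<Rightarrow> real) \<in> borel_measurable borel"
  proof -
    have "continuous_on UNIV (c2 :: 'a \<times> 'a \<Rightarrow> real)"
      unfolding c2_def case_prod_beta by (intro continuous_intros) auto
    then show ?thesis by (rule borel_measurable_continuous_onI)
  qed
  have c2Z: "c2 (Z t \<omega>) = (norm (D t \<omega>))\<^sup>2 / 2" for t \<omega>
    by (simp add: c2_def Z_def D_def)
  have sq: "integrable M (\<lambda>\<omega>. (norm (D t \<omega>))\<^sup>2)" if "t \<ge> 0" for t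
  proof -
    have "integrable (kernel J t (0, 0)) c2"
      using J(2) that by (simp add: extended_domain_def continuity_domain_def)
    then have "integrable M (\<lambda>\<omega>. c2 (Z t \<omega>))"
      unfolding law0[OF that] by (simp add: integrable_distr_eq[OF levy_processD(2)[OF Z that] c2m])
    then have "integrable M (\<lambda>\<omega>. 2 * c2 (Z t \<omega>))" by (intro integrable_mult_right)
    then show ?thesis by (simp add: c2Z)
  qed
  have exp_c2: "exp_op J t c2 (0, 0) = expectation (\<lambda>\<omega>. (norm (D t \<omega>))\<^sup>2) / 2" if "t \<ge> 0" for t
    by (simp add: exp_op_def kernel_op_def law0[OF that] integral_distr[OF levy_processD(2)[OF Z that] c2m] c2Z)

  \<comment> \<open>The factor \<open>2\<close> undoes the \<open>1/2\<close> in the cost \<open>c2\<close>, so \<open>v\<close> is the rate of \<open>E|D\<^sub>h|\<^sup>2\<close>.\<close>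
  define v where "v = 2 * extended_generator J c2 (0, 0)"
  have D0: "expectation (\<lambda>\<omega>. (norm (D 0 \<omega>))\<^sup>2) = 0"
  proof -
    have "expectation (\<lambda>\<omega>. (norm (D 0 \<omega>))\<^sup>2) = expectation (\<lambda>\<omega>. 0)"
      by (rule integral_cong_AE) (use levy_processD(2)[OF D, of 0] levy_processD(3)[OF D] in auto)
    then show ?thesis by simp
  qed
  have v: "((\<lambda>h. expectation (\<lambda>\<omega>. (norm (D h \<omega>))\<^sup>2) / h) \<longlongrightarrow> v) (at_right 0)"
  proof -
    have "((\<lambda>h. 2 * ((exp_op J h c2 (0, 0) - exp_op J 0 c2 (0, 0)) / h)) \<longlongrightarrow> v) (at_right 0)"
      unfolding v_def by (intro tendsto_intros extended_domain_right_derivative J(2))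
    moreover have "\<forall>\<^sub>F h in at_right 0. 2 * ((exp_op J h c2 (0, 0) - exp_op J 0 c2 (0, 0)) / h)
        = expectation (\<lambda>\<omega>. (norm (D h \<omega>))\<^sup>2) / h"
      using eventually_at_right_less[of "0::real"]
      by eventually_elim (simp add: exp_c2 D0)
    ultimately show ?thesis by (rule Lim_transform_eventually)
  qed
  have "v \<ge> 0"
    by (rule tendsto_lowerbound[OF v])
      (auto intro!: eventually_mono[OF eventually_at_right_less[of "0::real"]])

  define m where "m = mean_vector A - mean_vector B"
  have mean: "expectation (D 1) = m"
  proof -
    have m1: "X 1 \<in> borel_measurable M" "Y 1 \<in> borel_measurable M" "Z 1 \<in> borel_measurable M"
      using levy_processD(2)[OF X] levy_processD(2)[OF Y] levy_processD(2)[OF Z] by auto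
    have "fst \<in> borel_measurable (borel :: ('a \<times> 'a) measure)" "snd \<in> borel_measurable (borel :: ('a \<times> 'a) measure)"
      by (intro borel_measurable_continuous_onI continuous_intros)+
    then have "kernel A 1 0 = distr M borel (X 1)" "kernel B 1 0 = distr M borel (Y 1)"
      using coupling_marginals[OF AB J(1), of 1 0 0] m1
      by (simp_all add: law0 distr_distr comp_def Z_def)
    note mX = mean_vector_marginal[OF assms(1) prob_space_axioms m1(1) this(1)]
      and mY = mean_vector_marginal[OF assms(2) prob_space_axioms m1(2) this(2)]
    show ?thesis
      using mX mY by (simp add: D_def[abs_def] m_def)
  qed
  have W: "(wasserstein_generator_metric A B)\<^sup>2 = ((norm m)\<^sup>2 + v) / 2"
    using \<open>v \<ge> 0\<close> by (simp add: wasserstein_generator_metric_def J(3)[symmetric] m_def v_def)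
  have "(\<integral>\<^sup>+\<omega>. (SUP t\<in>{0..T}. ennreal ((norm (D t \<omega>))\<^sup>2)) \<partial>M)
      \<le> ennreal (8 * max T (T\<^sup>2) * (wasserstein_generator_metric A B)\<^sup>2)" if T: "T \<ge> 0" for T
  proof -
    have "4 * T * v + 2 * T\<^sup>2 * (norm m)\<^sup>2 \<le> 4 * max T (T\<^sup>2) * v + 4 * max T (T\<^sup>2) * (norm m)\<^sup>2"
      using T \<open>v \<ge> 0\<close> by (intro add_mono mult_right_mono) auto
    then have "ennreal (4 * T * v + 2 * T\<^sup>2 * (norm m)\<^sup>2)
        \<le> ennreal (8 * max T (T\<^sup>2) * (wasserstein_generator_metric A B)\<^sup>2)"
      unfolding W by (intro ennreal_leI) (simp add: algebra_simps)
    with levy_maximal_inequality_drift[OF D sq v T] show ?thesis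
      unfolding mean by (rule order_trans)
  qed
  moreover have "(\<integral>\<^sup>+\<omega>. (SUP t\<in>{0..T}. ennreal ((norm (D t \<omega>))\<^sup>2)) \<partial>M)
      \<le> ennreal (4 * T * (wasserstein_generator_metric A B)\<^sup>2)"
    if T: "T \<ge> 0" and "mean_vector A = 0" "mean_vector B = 0" for T
  proof -
    have "m = 0" using that by (simp add: m_def)
    then have "expectation (D t) = 0" if "t \<ge> 0" for t
      using levy_mean_linear[OF D sq v that] mean by simp
    from levy_maximal_inequality[OF D sq this v T] show ?thesis
      unfolding W using \<open>m = 0\<close> by (simp add: mult.assoc)
  qed
  ultimately show ?thesis unfolding D_def by blast
qed

end
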